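(* Suppose that $\Omega\subseteq\mathbb{R}^2$ is a bounded, open square, centred at the origin, and let $f\in \mathrm{BV}(\Omega)$ satisfy the following symmetry properties: (i) $f$ is symmetric with respect to both axes, i.e. $f(x_1,x_2)=f(-x_1,x_2)$ and $f(x_1,x_2)=f(x_1,-x_2)$ for a.e. $(x_1,x_2)\in\Omega$; (ii) $f$ is invariant under $\pi/2$ rotations, i.e. $f(O_{\pi/2}x)=f(x)$, where $O_{\pi/2}$ denotes counterclockwise rotation by $\pi/2$. Then if $\alpha,\beta>0$ and $\beta/\alpha>C_{\mathrm{BD}}$, the problems $$\min_{u\in\mathrm{BV}(\Omega)}\ \frac1p\int_\Omega|f-u|^p\,dx+\mathrm{TGV}^2_{\beta,\alpha}(u)\qquad\text{and}\qquad \min_{u\in\mathrm{BV}(\Omega)}\ \frac1p\int_\Omega|f-u|^p\,dx+\alpha\,\mathrm{TV}(u)$$ for $p\ge 1$ are equivalent.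
   Context: For an $\mathbb{R}^\ell$-valued distribution $\mathcal T$ on $\Omega$, the Radon norm is $\|\mathcal T\|_{\mathcal M}=\sup\{\langle \mathcal T,v\rangle: v\in C_c^\infty(\Omega;\mathbb{R}^\ell),\ \|v\|_\infty\le 1\}$. $\mathrm{BV}(\Omega)$ is the space of $u\in L^1(\Omega)$ whose distributional derivative $Du$ is a finite Radon measure, and $\mathrm{TV}(u)=\|Du\|_{\mathcal M}$. $\mathrm{BD}(\Omega)$ is the space of $w\in L^1(\Omega;\mathbb{R}^d)$ whose symmetrised distributional derivative $\mathcal{E}w$ is an $\mathbb{R}^{d\times d}$-valued finite Radon measure (here $d=2$). For $\alpha,\beta>0$ and $u\in L^1(\Omega)$, the second order total generalised variation is $$\mathrm{TGV}^2_{\beta,\alpha}(u)=\min_{w\in\mathrm{BD}(\Omega)}\alpha\|Du-w\|_{\mathcal M}+\beta\|\mathcal{E}w\|_{\mathcal M}.$$ $\mathrm{Ker}\,\mathcal{E}$ is the set of functions $r(x)=Ax+b$ with $b\in\mathbb{R}^d$ and $A\in\mathbb{R}^{d\times d}$ skew-symmetric. $C_{\mathrm{BD}}>0$ is the constant in the Sobolev--Korn inequality on $\Omega$: it depends only on $\Omega$, and for every $w\in\mathrm{BD}(\Omega)$ there exists $r_w\in\mathrm{Ker}\,\mathcal{E}$ with $\|w-r_w\|_{L^1(\Omega)}\le C_{\mathrm{BD}}\|\mathcal{E}w\|_{\mathcal M}$.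
   Formalization: "Equivalent" means equal sets of minimisers only for p>1 (this fails at p=1); for all p≥1: equal infima, every TV minimiser is a TGV minimiser, symmetric functions minimise both or neither, and if TGV has a minimiser there is a common symmetric one. *)

theory Defs
  imports "HOL-Analysis.Analysis"
begin

section \<open>Test fields\<close>

primrec Ck :: "nat \<Rightarrow> ('a::euclidean_space \<Rightarrow> 'b::real_normed_vector) \<Rightarrow> bool" where
  "Ck 0 \<phi> \<longleftrightarrow> continuous_on UNIV \<phi>"
| "Ck (Suc k) \<phi> \<longleftrightarrow>
     (\<forall>x. \<phi> differentiable (at x)) \<and> (\<forall>h. Ck k (\<lambda>x. frechet_derivative \<phi> (at x) h))"

text \<open>Elements of \<open>C\<^sub>c\<^sup>\<infinity>(\<Omega>)\<close> are represented by their extension by zero to the whole space.\<close>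

definition test_field :: "'a::euclidean_space set \<Rightarrow> ('a \<Rightarrow> 'b::real_normed_vector) \<Rightarrow> bool" where
  "test_field \<Omega> \<phi> \<longleftrightarrow> (\<forall>k. Ck k \<phi>) \<and>
     compact (closure {x. \<phi> x \<noteq> 0}) \<and> closure {x. \<phi> x \<noteq> 0} \<subseteq> \<Omega>"

definition partial_deriv :: "'n \<Rightarrow> (real^'n \<Rightarrow> real) \<Rightarrow> real^'n \<Rightarrow> real" where
  "partial_deriv j \<phi> x = frechet_derivative \<phi> (at x) (axis j 1)"


section \<open>Distributions and Radon norm\<close>

text \<open>A distribution on \<open>\<Omega>\<close> is represented by its action on test fields; its values at other
  arguments are irrelevant. A locally integrable field \<open>w\<close> is identified with
  \<open>v \<mapsto> \<integral>\<^sub>\<Omega> w \<bullet> v\<close>.\<close>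

type_synonym ('a, 'b) distribution = "('a \<Rightarrow> 'b) \<Rightarrow> real"

definition field_dist ::
    "(real^'n) set \<Rightarrow> (real^'n \<Rightarrow> 'b::euclidean_space) \<Rightarrow> (real^'n, 'b) distribution" where
  "field_dist \<Omega> w v = (\<integral>x. w x \<bullet> v x \<partial>lebesgue_on \<Omega>)"

definition grad_dist ::
    "(real^'n) set \<Rightarrow> (real^'n \<Rightarrow> real) \<Rightarrow> (real^'n, real^'n) distribution" where
  "grad_dist \<Omega> u v =
     - (\<integral>x. u x * (\<Sum>i\<in>UNIV. partial_deriv i (\<lambda>y. v y $ i) x) \<partial>lebesgue_on \<Omega>)"

text \<open>The symmetrised derivative has entries \<open>(\<partial>\<^sub>j w\<^sub>i + \<partial>\<^sub>i w\<^sub>j) / 2\<close> and is tested against all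
  matrix fields, not only symmetric ones.\<close>

definition sym_grad_dist ::
    "(real^'n) set \<Rightarrow> (real^'n \<Rightarrow> real^'n) \<Rightarrow> (real^'n, real^'n^'n) distribution" where
  "sym_grad_dist \<Omega> w V =
     - (\<integral>x. (\<Sum>i\<in>UNIV. \<Sum>j\<in>UNIV.
           (w x $ i * partial_deriv j (\<lambda>y. V y $ i $ j) x
          + w x $ j * partial_deriv i (\<lambda>y. V y $ i $ j) x) / 2) \<partial>lebesgue_on \<Omega>)"

text \<open>On matrices the norm below is the Frobenius norm. Passing to \<open>ennreal\<close> truncates negative
  values, which does not affect the supremum because \<open>v = 0\<close> is admissible.\<close>

definition radon_norm ::
    "'a::euclidean_space set \<Rightarrow> ('a, 'b::euclidean_space) distribution \<Rightarrow> ennreal" where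
  "radon_norm \<Omega> T = (SUP v \<in> {v. test_field \<Omega> v \<and> (\<forall>x. norm (v x) \<le> 1)}. ennreal (T v))"

text \<open>A finite vector-valued Radon measure on \<open>\<Omega>\<close> is given by \<open>\<sigma> \<mu>\<close>, where \<open>\<mu>\<close> is a finite positive
  Borel measure and \<open>\<sigma>\<close> a \<open>\<mu>\<close>-integrable vector-valued density (polar decomposition);
  on open subsets of a Euclidean space every finite Borel measure is a Radon measure.\<close>

definition is_finite_radon_measure ::
    "'a::euclidean_space set \<Rightarrow> ('a, 'b::euclidean_space) distribution \<Rightarrow> bool" where
  "is_finite_radon_measure \<Omega> T \<longleftrightarrow>
     (\<exists>\<mu> \<sigma>. finite_measure \<mu> \<and> sets \<mu> = sets (restrict_space borel \<Omega>) \<and> integrable \<mu> \<sigma> \<and>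
        (\<forall>v. test_field \<Omega> v \<longrightarrow> T v = (\<integral>x. \<sigma> x \<bullet> v x \<partial>\<mu>)))"


section \<open>The spaces BV and BD, total variation and total generalised variation\<close>

definition BV :: "(real^'n) set \<Rightarrow> (real^'n \<Rightarrow> real) set" where
  "BV \<Omega> = {u. integrable (lebesgue_on \<Omega>) u \<and> is_finite_radon_measure \<Omega> (grad_dist \<Omega> u)}"

definition BD :: "(real^'n) set \<Rightarrow> (real^'n \<Rightarrow> real^'n) set" where
  "BD \<Omega> = {w. integrable (lebesgue_on \<Omega>) w \<and> is_finite_radon_measure \<Omega> (sym_grad_dist \<Omega> w)}"

definition TV :: "(real^'n) set \<Rightarrow> (real^'n \<Rightarrow> real) \<Rightarrow> ennreal" where
  "TV \<Omega> u = radon_norm \<Omega> (grad_dist \<Omega> u)"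

definition TGV2 :: "(real^'n) set \<Rightarrow> real \<Rightarrow> real \<Rightarrow> (real^'n \<Rightarrow> real) \<Rightarrow> ennreal" where
  "TGV2 \<Omega> \<beta> \<alpha> u =
     (INF w \<in> BD \<Omega>. ennreal \<alpha> * radon_norm \<Omega> (\<lambda>v. grad_dist \<Omega> u v - field_dist \<Omega> w v)
                  + ennreal \<beta> * radon_norm \<Omega> (sym_grad_dist \<Omega> w))"

definition KerE :: "(real^'n \<Rightarrow> real^'n) set" where
  "KerE = {\<lambda>x. A *v x + b | A b. transpose A = - A}"

definition sobolev_korn_constant :: "(real^'n) set \<Rightarrow> real \<Rightarrow> bool" where
  "sobolev_korn_constant \<Omega> C \<longleftrightarrow> C > 0 \<and>
     (\<forall>w \<in> BD \<Omega>. \<exists>r \<in> KerE.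
        (\<integral>\<^sup>+x. ennreal (norm (w x - r x)) \<partial>lebesgue_on \<Omega>)
          \<le> ennreal C * radon_norm \<Omega> (sym_grad_dist \<Omega> w))"


section \<open>The variational problems\<close>

definition fidelity ::
    "(real^'n) set \<Rightarrow> real \<Rightarrow> (real^'n \<Rightarrow> real) \<Rightarrow> (real^'n \<Rightarrow> real) \<Rightarrow> ennreal" where
  "fidelity \<Omega> p f u = ennreal (1 / p) * (\<integral>\<^sup>+x. ennreal (\<bar>f x - u x\<bar> powr p) \<partial>lebesgue_on \<Omega>)"

definition TGV_objective ::
    "(real^'n) set \<Rightarrow> real \<Rightarrow> (real^'n \<Rightarrow> real) \<Rightarrow> real \<Rightarrow> real \<Rightarrow> (real^'n \<Rightarrow> real) \<Rightarrow> ennreal" where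
  "TGV_objective \<Omega> p f \<beta> \<alpha> u = fidelity \<Omega> p f u + TGV2 \<Omega> \<beta> \<alpha> u"

definition TV_objective ::
    "(real^'n) set \<Rightarrow> real \<Rightarrow> (real^'n \<Rightarrow> real) \<Rightarrow> real \<Rightarrow> (real^'n \<Rightarrow> real) \<Rightarrow> ennreal" where
  "TV_objective \<Omega> p f \<alpha> u = fidelity \<Omega> p f u + ennreal \<alpha> * TV \<Omega> u"

abbreviation TGV_solution ::
    "(real^'n) set \<Rightarrow> real \<Rightarrow> (real^'n \<Rightarrow> real) \<Rightarrow> real \<Rightarrow> real \<Rightarrow> (real^'n \<Rightarrow> real) \<Rightarrow> bool" where
  "TGV_solution \<Omega> p f \<beta> \<alpha> \<equiv> is_arg_min (TGV_objective \<Omega> p f \<beta> \<alpha>) (\<lambda>u. u \<in> BV \<Omega>)"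

abbreviation TV_solution ::
    "(real^'n) set \<Rightarrow> real \<Rightarrow> (real^'n \<Rightarrow> real) \<Rightarrow> real \<Rightarrow> (real^'n \<Rightarrow> real) \<Rightarrow> bool" where
  "TV_solution \<Omega> p f \<alpha> \<equiv> is_arg_min (TV_objective \<Omega> p f \<alpha>) (\<lambda>u. u \<in> BV \<Omega>)"


section \<open>Square domain and symmetries\<close>

definition centred_open_square :: "(real^2) set \<Rightarrow> bool" where
  "centred_open_square \<Omega> \<longleftrightarrow>
     (\<exists>(a::real) (R :: real^2 \<Rightarrow> real^2). a > 0 \<and> orthogonal_transformation R \<and> \<Omega> = R ` {x. \<forall>i. \<bar>x $ i\<bar> < a})"

text \<open>The square may be tilted, so the domain is required to contain the reflected points
  at which \<open>u\<close> is evaluated; this excludes all orientations but two, with the sides or with the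
  diagonals parallel to the coordinate axes.\<close>

definition axes_symmetric :: "(real^2) set \<Rightarrow> (real^2 \<Rightarrow> real) \<Rightarrow> bool" where
  "axes_symmetric \<Omega> u \<longleftrightarrow>
     (\<forall>x\<in>\<Omega>. vector [- x $ 1, x $ 2] \<in> \<Omega> \<and> vector [x $ 1, - x $ 2] \<in> \<Omega>) \<and>
     (AE x in lebesgue_on \<Omega>. u x = u (vector [- x $ 1, x $ 2])) \<and>
     (AE x in lebesgue_on \<Omega>. u x = u (vector [x $ 1, - x $ 2]))"

definition quarter_turn_invariant :: "(real^2) set \<Rightarrow> (real^2 \<Rightarrow> real) \<Rightarrow> bool" where
  "quarter_turn_invariant \<Omega> u \<longleftrightarrow>
     (AE x in lebesgue_on \<Omega>. u (vector [- x $ 2, x $ 1]) = u x)"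

end

theory Submission
  imports Defs
begin

text \<open>
  Averaging \<open>u\<close> over the dihedral group of the square gives \<open>u'\<close>, and the action of \<open>Du'\<close> on a test field
  \<open>v\<close> is the action of \<open>Du\<close> on the averaged field \<open>V\<close>. Every \<open>r \<in> Ker \<E>\<close> integrates to zero against \<open>V\<close>,
  because the average of \<open>r\<close> over the group vanishes. Hence, for \<open>w \<in> BD\<close> with Sobolev--Korn projection
  \<open>r\<close>, \<open>\<langle>Du', v\<rangle> = \<langle>Du - w, V\<rangle> + \<langle>w - r, V\<rangle> \<le> \<parallel>Du - w\<parallel> + C \<parallel>\<E>w\<parallel>\<close>, so that \<open>\<alpha> TV(u') \<le> TGV(u) \<le> \<alpha> TV(u)\<close>.
  By convexity averaging does not increase the fidelity to a symmetric \<open>f\<close>, and for \<open>p > 1\<close> it preserves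
  a finite fidelity only if \<open>u' = u\<close> almost everywhere. The group average is composed of the averages over
  the two axis reflections and the swap of the coordinates, so that only involutions have to be treated.
\<close>

section \<open>Finite Radon measures\<close>

text \<open>Radon--Nikodym: the new density is \<open>\<sigma>\<close> times the derivative of
  \<open>N\<close> with respect to \<open>M\<close>. Measurability of \<open>v\<close> suffices,
  since both integrals are zero by convention when the integrand is not integrable.\<close>

lemma ex_density_wrt_dominating_measure:
  fixes \<sigma> :: "'a \<Rightarrow> 'b::euclidean_space"
  assumes M: "finite_measure M" and N: "finite_measure N" and sets: "sets N = sets M"
    and ac: "absolutely_continuous M N" and \<sigma>: "integrable N \<sigma>"
  obtains \<tau> where "integrable M \<tau>"
    and "\<And>v. v \<in> borel_measurable M \<Longrightarrow> (\<integral>x. \<sigma> x \<bullet> v x \<partial>N) = (\<integral>x. \<tau> x \<bullet> v x \<partial>M)"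
proof
  interpret M: finite_measure M by fact
  interpret N: finite_measure N by fact
  have sf: "sigma_finite_measure N"
    by (rule N.sigma_finite_measure_axioms)
  have [measurable]: "\<sigma> \<in> borel_measurable M"
    using borel_measurable_integrable[OF \<sigma>] measurable_cong_sets[OF sets refl] by blast
  let ?\<tau> = "\<lambda>x. enn2real (RN_deriv M N x) *\<^sub>R \<sigma> x"
  have "integrable M (\<lambda>x. enn2real (RN_deriv M N x) * norm (\<sigma> x))"
    using \<sigma> by (subst M.RN_deriv_integrable[OF sf ac sets, symmetric]) auto
  then show "integrable M ?\<tau>"
    by (rule Bochner_Integration.integrable_bound) auto
  show "(\<integral>x. \<sigma> x \<bullet> v x \<partial>N) = (\<integral>x. ?\<tau> x \<bullet> v x \<partial>M)" if "v \<in> borel_measurable M" for v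
    using that by (subst M.RN_deriv_integral[OF sf ac sets]) auto
qed

text \<open>The sum dominates both measures, so it serves as a common reference measure for two
  densities.\<close>

lemma ex_finite_measure_sum:
  assumes M: "finite_measure M" and N: "finite_measure N" and sets: "sets N = sets M"
  obtains S where "finite_measure S" "sets S = sets M"
    "\<And>A. A \<in> sets M \<Longrightarrow> emeasure S A = emeasure M A + emeasure N A"
proof
  let ?S = "measure_of (space M) (sets M) (\<lambda>A. emeasure M A + emeasure N A)"
  show sets_S: "sets ?S = sets M"
    by simp
  show eq: "emeasure ?S A = emeasure M A + emeasure N A" if "A \<in> sets M" for A
  proof (rule emeasure_measure_of_sigma[OF sets.sigma_algebra_axioms _ _ that])
    show "positive (sets M) (\<lambda>A. emeasure M A + emeasure N A)"
      by (simp add: positive_def)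
    show "countably_additive (sets M) (\<lambda>A. emeasure M A + emeasure N A)"
    proof (rule countably_additiveI)
      fix A :: "nat \<Rightarrow> 'a set" assume A: "range A \<subseteq> sets M" "disjoint_family A"
      show "(\<Sum>i. emeasure M (A i) + emeasure N (A i)) = emeasure M (\<Union>i. A i) + emeasure N (\<Union>i. A i)"
        using A sets by (simp add: suminf_add[symmetric] suminf_emeasure)
    qed
  qed
  show "finite_measure ?S"
  proof (rule finite_measureI)
    have "space ?S = space M"
      by simp
    then have "emeasure ?S (space ?S) = emeasure M (space M) + emeasure N (space N)"
      using eq[of "space M"] sets_eq_imp_space_eq[OF sets] by simp
    then show "emeasure ?S (space ?S) \<noteq> \<infinity>"
      using finite_measure.emeasure_finite[OF M] finite_measure.emeasure_finite[OF N] by simp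
  qed
qed

lemma test_field_continuous: "test_field \<Omega> v \<Longrightarrow> continuous_on UNIV v"
  unfolding test_field_def using Ck.simps(1) by blast

lemma test_field_borel_measurable:
  assumes "test_field \<Omega> (v :: 'a::euclidean_space \<Rightarrow> 'b::euclidean_space)"
    and "sets \<mu> = sets (restrict_space borel \<Omega>)"
  shows "v \<in> borel_measurable \<mu>"
proof -
  have "v \<in> borel_measurable borel"
    using test_field_continuous[OF assms(1)] by (rule borel_measurable_continuous_onI)
  then show ?thesis
    using measurable_restrict_space1 measurable_cong_sets[OF assms(2) refl] by blast
qed

lemma is_finite_radon_measure_cong:
  assumes "\<And>v. test_field \<Omega> v \<Longrightarrow> T v = T' v" and "is_finite_radon_measure \<Omega> T"
  shows "is_finite_radon_measure \<Omega> T'"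
  using assms unfolding is_finite_radon_measure_def by metis

text \<open>Makes \<open>w = 0\<close> an admissible field in the infimum defining
  \<open>TGV2\<close>.\<close>

lemma is_finite_radon_measure_zero: "is_finite_radon_measure \<Omega> (\<lambda>v. 0)"
  unfolding is_finite_radon_measure_def
  by (intro exI[of _ "null_measure (restrict_space borel \<Omega>)"] exI[of _ "\<lambda>x. 0"])
    (auto intro: finite_measureI)

lemma is_finite_radon_measure_scale:
  assumes "is_finite_radon_measure \<Omega> T"
  shows "is_finite_radon_measure \<Omega> (\<lambda>v. c * T v)"
proof -
  obtain \<mu> \<sigma> where \<mu>: "finite_measure \<mu>" "sets \<mu> = sets (restrict_space borel \<Omega>)" "integrable \<mu> \<sigma>"
    and T: "\<And>v. test_field \<Omega> v \<Longrightarrow> T v = (\<integral>x. \<sigma> x \<bullet> v x \<partial>\<mu>)"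
    using assms unfolding is_finite_radon_measure_def by blast
  then show ?thesis
    unfolding is_finite_radon_measure_def
    by (intro exI[of _ \<mu>] exI[of _ "\<lambda>x. c *\<^sub>R \<sigma> x"]) auto
qed

lemma is_finite_radon_measure_add:
  fixes T\<^sub>1 T\<^sub>2 :: "('a::euclidean_space \<Rightarrow> 'b::euclidean_space) \<Rightarrow> real"
  assumes "is_finite_radon_measure \<Omega> T\<^sub>1" and "is_finite_radon_measure \<Omega> T\<^sub>2"
  shows "is_finite_radon_measure \<Omega> (\<lambda>v. T\<^sub>1 v + T\<^sub>2 v)"
proof -
  let ?B = "restrict_space borel \<Omega>"
  obtain M \<sigma> where M: "finite_measure M" "sets M = sets ?B" "integrable M \<sigma>"
    and T1: "\<And>v. test_field \<Omega> v \<Longrightarrow> T\<^sub>1 v = (\<integral>x. \<sigma> x \<bullet> v x \<partial>M)"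
    using assms(1) unfolding is_finite_radon_measure_def by blast
  obtain N \<tau> where N: "finite_measure N" "sets N = sets ?B" "integrable N \<tau>"
    and T2: "\<And>v. test_field \<Omega> v \<Longrightarrow> T\<^sub>2 v = (\<integral>x. \<tau> x \<bullet> v x \<partial>N)"
    using assms(2) unfolding is_finite_radon_measure_def by blast
  \<comment> \<open>The two functionals have densities over unrelated measures. Both densities are
    rewritten over the sum of these measures and can then be added pointwise.\<close>
  obtain S where S: "finite_measure S" "sets S = sets M"
    and S_eq: "\<And>A. A \<in> sets M \<Longrightarrow> emeasure S A = emeasure M A + emeasure N A"
    using ex_finite_measure_sum[OF M(1) N(1)] M(2) N(2) by metis
  have ac: "absolutely_continuous S M" "absolutely_continuous S N"
    using S(2) M(2) N(2) S_eq unfolding absolutely_continuous_def null_sets_def by auto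
  have sets_eq: "sets M = sets S" "sets N = sets S"
    using S(2) M(2) N(2) by simp_all
  obtain \<sigma>' where d1: "integrable S \<sigma>'"
    and \<sigma>': "\<And>v. v \<in> borel_measurable S \<Longrightarrow> (\<integral>x. \<sigma> x \<bullet> v x \<partial>M) = (\<integral>x. \<sigma>' x \<bullet> v x \<partial>S)"
    using ex_density_wrt_dominating_measure[OF S(1) M(1) sets_eq(1) ac(1) M(3)] by blast
  obtain \<tau>' where d2: "integrable S \<tau>'"
    and \<tau>': "\<And>v. v \<in> borel_measurable S \<Longrightarrow> (\<integral>x. \<tau> x \<bullet> v x \<partial>N) = (\<integral>x. \<tau>' x \<bullet> v x \<partial>S)"
    using ex_density_wrt_dominating_measure[OF S(1) N(1) sets_eq(2) ac(2) N(3)] by blast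
  \<comment> \<open>Splitting the integral of the summed density needs integrability of each part. A
    test field is continuous with compact support, hence bounded.\<close>
  have dot: "integrable S (\<lambda>x. \<rho> x \<bullet> v x)"
    if "integrable S \<rho>" and v: "test_field \<Omega> v" for \<rho> v :: "'a \<Rightarrow> 'b"
  proof -
    have m[measurable]: "v \<in> borel_measurable S"
      using test_field_borel_measurable[OF v] S(2) M(2) by simp
    have "compact (closure {x. v x \<noteq> 0})"
      using v by (simp add: test_field_def)
    moreover have "continuous_on (closure {x. v x \<noteq> 0}) v"
      using test_field_continuous[OF v] continuous_on_subset by blast
    ultimately have "bounded (v ` closure {x. v x \<noteq> 0})"
      using compact_continuous_image compact_imp_bounded by blast
    then obtain B where B: "\<And>x. x \<in> closure {x. v x \<noteq> 0} \<Longrightarrow> norm (v x) \<le> B" and "B > 0"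
      unfolding bounded_pos by auto
    have bd: "norm (v x) \<le> B" for x
      using B[of x] \<open>B > 0\<close> closure_subset[of "{x. v x \<noteq> 0}"] by (cases "v x = 0") auto
    show ?thesis
    proof (rule Bochner_Integration.integrable_bound)
      show "integrable S (\<lambda>x. B *\<^sub>R \<rho> x)"
        using that(1) by simp
      show "(\<lambda>x. \<rho> x \<bullet> v x) \<in> borel_measurable S"
        using that(1) by measurable
      have "norm (\<rho> x \<bullet> v x) \<le> norm (B *\<^sub>R \<rho> x)" for x
      proof -
        have "norm (\<rho> x \<bullet> v x) \<le> norm (\<rho> x) * norm (v x)"
          by (simp add: Cauchy_Schwarz_ineq2)
        also have "\<dots> \<le> norm (\<rho> x) * B"
          using bd by (simp add: mult_left_mono)
        finally show ?thesis
          using \<open>B > 0\<close> by (simp add: mult.commute)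
      qed
      then show "AE x in S. norm (\<rho> x \<bullet> v x) \<le> norm (B *\<^sub>R \<rho> x)"
        by simp
    qed
  qed
  have "T\<^sub>1 v + T\<^sub>2 v = (\<integral>x. (\<sigma>' x + \<tau>' x) \<bullet> v x \<partial>S)" if v: "test_field \<Omega> v" for v
    using T1[OF v] T2[OF v] \<sigma>'[of v] \<tau>'[of v] test_field_borel_measurable[OF v] S(2) M(2)
      dot[OF d1 v] dot[OF d2 v]
    by (simp add: inner_add_left)
  then show ?thesis
    unfolding is_finite_radon_measure_def using S(1) S(2) M(2) d1 d2
    by (intro exI[of _ S] exI[of _ "\<lambda>x. \<sigma>' x + \<tau>' x"]) auto
qed

text \<open>For \<open>norm (v x) \<le> 1\<close>, Cauchy--Schwarz bounds the integrand by
  \<open>norm (\<sigma> x)\<close>. This will show that the objectives are finite at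
  \<open>f\<close>.\<close>

lemma radon_norm_finite:
  assumes "is_finite_radon_measure \<Omega> T"
  shows "radon_norm \<Omega> T < \<infinity>"
proof -
  obtain \<mu> \<sigma> where \<mu>: "finite_measure \<mu>" "sets \<mu> = sets (restrict_space borel \<Omega>)" "integrable \<mu> \<sigma>"
    and T: "\<And>v. test_field \<Omega> v \<Longrightarrow> T v = (\<integral>x. \<sigma> x \<bullet> v x \<partial>\<mu>)"
    using assms unfolding is_finite_radon_measure_def by blast
  have "T v \<le> (\<integral>x. norm (\<sigma> x) \<partial>\<mu>)" if v: "test_field \<Omega> v" "\<forall>x. norm (v x) \<le> 1" for v
  proof -
    have "\<sigma> x \<bullet> v x \<le> norm (\<sigma> x)" for x
      using norm_cauchy_schwarz[of "\<sigma> x" "v x"] v(2)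
      by (meson mult_left_le norm_ge_zero order_trans)
    then have "(\<integral>x. \<sigma> x \<bullet> v x \<partial>\<mu>) \<le> (\<integral>x. norm (\<sigma> x) \<partial>\<mu>)"
      using \<mu>(3) by (intro integral_mono') auto
    then show ?thesis
      using T[OF v(1)] by simp
  qed
  then have "radon_norm \<Omega> T \<le> ennreal (\<integral>x. norm (\<sigma> x) \<partial>\<mu>)"
    unfolding radon_norm_def by (intro SUP_least) (auto intro: ennreal_leI)
  then show ?thesis
    by (metis ennreal_less_top infinity_ennreal_def le_less_trans)
qed

section \<open>Test fields\<close>

text \<open>The derivative of the composite in direction \<open>h\<close> is again a composite of
  the same shape, with \<open>\<phi>\<close> replaced by its derivative in the fixed direction
  \<open>H h\<close>; hence the induction over arbitrary \<open>\<phi>\<close>.\<close>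

lemma Ck_compose_bounded_linear:
  assumes "bounded_linear G" and "bounded_linear H" and "Ck k \<phi>"
  shows "Ck k (\<lambda>x. G (\<phi> (H x)))"
  using assms(3)
proof (induction k arbitrary: \<phi>)
  case 0
  then have \<phi>: "continuous_on UNIV \<phi>"
    by simp
  have "continuous_on UNIV (\<lambda>x. \<phi> (H x))"
    by (rule continuous_on_compose2[OF \<phi> linear_continuous_on[OF assms(2)]]) simp
  from bounded_linear.continuous_on[OF assms(1) this] show ?case
    by simp
next
  case (Suc k)
  have d: "((\<lambda>x. G (\<phi> (H x))) has_derivative (\<lambda>h. G (frechet_derivative \<phi> (at (H x)) (H h)))) (at x)" for x
  proof -
    have "(\<phi> has_derivative frechet_derivative \<phi> (at (H x))) (at (H x))"
      using Suc.prems frechet_derivative_works by auto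
    then have "((\<lambda>x. \<phi> (H x)) has_derivative (\<lambda>h. frechet_derivative \<phi> (at (H x)) (H h))) (at x)"
      using has_derivative_compose bounded_linear_imp_has_derivative[OF assms(2)] by fast
    then show ?thesis
      by (rule bounded_linear.has_derivative[OF assms(1)])
  qed
  have "Ck k (\<lambda>x. G (frechet_derivative \<phi> (at (H x)) (H h)))" for h
    using Suc.IH[of "\<lambda>x. frechet_derivative \<phi> (at x) (H h)"] Suc.prems by simp
  then show ?case
    using d frechet_derivative_at[OF d, symmetric] unfolding Ck.simps differentiable_def by auto
qed

lemma Ck_add:
  assumes "Ck k \<phi>" and "Ck k \<psi>"
  shows "Ck k (\<lambda>x. \<phi> x + \<psi> x)"
  using assms
proof (induction k arbitrary: \<phi> \<psi>)
  case 0
  then show ?case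
    by (simp add: continuous_on_add)
next
  case (Suc k)
  have "((\<lambda>x. \<phi> x + \<psi> x) has_derivative
      (\<lambda>h. frechet_derivative \<phi> (at x) h + frechet_derivative \<psi> (at x) h)) (at x)" for x
    using Suc.prems by (intro has_derivative_add) (auto simp: frechet_derivative_works[symmetric])
  then have "frechet_derivative (\<lambda>x. \<phi> x + \<psi> x) (at x) =
      (\<lambda>h. frechet_derivative \<phi> (at x) h + frechet_derivative \<psi> (at x) h)" for x
    using frechet_derivative_at[symmetric] by blast
  then show ?case
    using Suc by simp
qed

lemma test_field_add:
  assumes "test_field \<Omega> v" and "test_field \<Omega> w"
  shows "test_field \<Omega> (\<lambda>x. v x + w x)"
proof -
  let ?S = "closure {x. v x \<noteq> 0} \<union> closure {x. w x \<noteq> 0}"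
  have S: "compact ?S" "?S \<subseteq> \<Omega>"
    using assms by (auto simp: test_field_def)
  have sub: "closure {x. v x + w x \<noteq> 0} \<subseteq> ?S"
    unfolding closure_Un[symmetric] by (rule closure_mono) auto
  then have "compact (closure {x. v x + w x \<noteq> 0})"
    using compact_imp_bounded[OF S(1)] bounded_subset compact_eq_bounded_closed by blast
  moreover have "closure {x. v x + w x \<noteq> 0} \<subseteq> \<Omega>"
    using sub S(2) by (rule order_trans)
  moreover have "Ck k (\<lambda>x. v x + w x)" for k
    using assms Ck_add[of k v w] by (simp add: test_field_def)
  ultimately show ?thesis
    by (simp add: test_field_def)
qed

text \<open>Since \<open>H\<close> is its own inverse, the support of the composite lies in the
  image under \<open>H\<close> of the support of \<open>v\<close>, which is compact and stays inside
  \<Omega>.\<close>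

lemma test_field_compose_linear:
  assumes v: "test_field \<Omega> v" and G: "bounded_linear G" and H: "bounded_linear H"
    and inv: "\<And>x. H (H x) = x" and \<Omega>: "\<And>x. x \<in> \<Omega> \<Longrightarrow> H x \<in> \<Omega>"
  shows "test_field \<Omega> (\<lambda>x. G (v (H x)))"
proof -
  let ?S = "closure {x. v x \<noteq> 0}"
  have S: "compact ?S" "?S \<subseteq> \<Omega>"
    using v by (auto simp: test_field_def)
  have c: "compact (H ` ?S)"
    using S(1) bounded_linear.continuous_on[OF H continuous_on_id] by (rule compact_continuous_image[rotated])
  have "{x. G (v (H x)) \<noteq> 0} \<subseteq> H ` ?S"
  proof
    fix x assume "x \<in> {x. G (v (H x)) \<noteq> 0}"
    then have "v (H x) \<noteq> 0"
      using linear_0[OF bounded_linear.linear[OF G]] by auto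
    then have "H x \<in> ?S"
      using closure_subset[of "{x. v x \<noteq> 0}"] by blast
    then show "x \<in> H ` ?S"
      using inv by (metis imageI)
  qed
  then have sub: "closure {x. G (v (H x)) \<noteq> 0} \<subseteq> H ` ?S"
    using c by (simp add: closure_minimal compact_imp_closed)
  moreover have "H ` ?S \<subseteq> \<Omega>"
    using S(2) \<Omega> by blast
  moreover have "compact (closure {x. G (v (H x)) \<noteq> 0})"
    using sub compact_imp_bounded[OF c] bounded_subset compact_eq_bounded_closed by blast
  ultimately show ?thesis
    using v Ck_compose_bounded_linear[OF G H] by (auto simp: test_field_def)
qed

section \<open>The divergence and its pairing with integrable functions\<close>

definition divergence :: "(real^'n \<Rightarrow> real^'n) \<Rightarrow> real^'n \<Rightarrow> real" where
  "divergence v x = (\<Sum>i\<in>UNIV. partial_deriv i (\<lambda>y. v y $ i) x)"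

lemma grad_dist_divergence: "grad_dist \<Omega> u v = - (\<integral>x. u x * divergence v x \<partial>lebesgue_on \<Omega>)"
  by (simp add: grad_dist_def divergence_def)

text \<open>The trace form reduces the behaviour of the divergence under orthogonal changes of
  variables to the cyclicity of the trace.\<close>

lemma divergence_has_derivative:
  assumes "(v has_derivative D) (at x)"
  shows "divergence v x = trace (matrix D)"
proof -
  have "((\<lambda>y. v y $ i) has_derivative (\<lambda>h. D h $ i)) (at x)" for i
    using assms by (rule bounded_linear.has_derivative[OF bounded_linear_vec_nth])
  then have "frechet_derivative (\<lambda>y. v y $ i) (at x) = (\<lambda>h. D h $ i)" for i
    using frechet_derivative_at[symmetric] by blast
  then show ?thesis
    by (simp add: divergence_def partial_deriv_def trace_def matrix_def)
qed

lemma test_field_has_derivative: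
  "test_field \<Omega> v \<Longrightarrow> (v has_derivative frechet_derivative v (at x)) (at x)"
  unfolding test_field_def using Ck.simps(2) frechet_derivative_works by blast

lemma continuous_on_divergence:
  assumes "test_field \<Omega> v"
  shows "continuous_on UNIV (divergence v)"
proof -
  have "Ck (Suc 0) v"
    using assms by (simp add: test_field_def)
  then have "continuous_on UNIV (\<lambda>x. frechet_derivative v (at x) h)" for h
    by simp
  then have "continuous_on UNIV (\<lambda>x. \<Sum>i\<in>UNIV. frechet_derivative v (at x) (axis i 1) $ i)"
    by (intro continuous_intros)
  moreover have "divergence v = (\<lambda>x. \<Sum>i\<in>UNIV. frechet_derivative v (at x) (axis i 1) $ i)"
    using divergence_has_derivative[OF test_field_has_derivative[OF assms]]
    by (auto simp: trace_def matrix_def)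
  ultimately show ?thesis
    by simp
qed

text \<open>Only continuity of \<open>v\<close> is assumed; its bound comes from compactness of the
  closure of the bounded set \<Omega>.\<close>

lemma integrable_inner_continuous:
  fixes u v :: "'a::euclidean_space \<Rightarrow> 'b::euclidean_space"
  assumes u: "integrable (lebesgue_on \<Omega>) u" and v: "continuous_on UNIV v"
    and \<Omega>: "bounded \<Omega>" "\<Omega> \<in> sets lebesgue"
  shows "integrable (lebesgue_on \<Omega>) (\<lambda>x. u x \<bullet> v x)"
proof -
  have v': "continuous_on S v" for S
    using v by (rule continuous_on_subset) simp
  have "bounded (v ` closure \<Omega>)"
    using \<Omega>(1) by (intro compact_imp_bounded compact_continuous_image v') simp
  then obtain B where B: "\<And>x. x \<in> closure \<Omega> \<Longrightarrow> norm (v x) \<le> B" and "B > 0"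
    unfolding bounded_pos by auto
  have [measurable]: "v \<in> borel_measurable (lebesgue_on \<Omega>)"
    using v' \<Omega>(2) by (rule continuous_imp_measurable_on_sets_lebesgue)
  show ?thesis
  proof (rule Bochner_Integration.integrable_bound)
    show "integrable (lebesgue_on \<Omega>) (\<lambda>x. B *\<^sub>R u x)"
      using u by simp
    show "(\<lambda>x. u x \<bullet> v x) \<in> borel_measurable (lebesgue_on \<Omega>)"
      using u by measurable
    have "norm (u x \<bullet> v x) \<le> norm (B *\<^sub>R u x)" if "x \<in> \<Omega>" for x
    proof -
      have "norm (u x \<bullet> v x) \<le> norm (u x) * norm (v x)"
        by (simp add: Cauchy_Schwarz_ineq2)
      also have "\<dots> \<le> norm (u x) * B"
        using B[of x] that closure_subset by (intro mult_left_mono) auto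
      finally show ?thesis
        using \<open>B > 0\<close> by (simp add: mult.commute)
    qed
    then show "AE x in lebesgue_on \<Omega>. norm (u x \<bullet> v x) \<le> norm (B *\<^sub>R u x)"
      by (intro AE_I2) simp
  qed
qed

lemma integrable_mult_divergence:
  assumes "integrable (lebesgue_on \<Omega>) u" and "test_field \<Omega> v"
    and "bounded \<Omega>" "\<Omega> \<in> sets lebesgue"
  shows "integrable (lebesgue_on \<Omega>) (\<lambda>x. u x * divergence v x)"
  using integrable_inner_continuous[OF assms(1) continuous_on_divergence[OF assms(2)] assms(3,4)] by simp

section \<open>Averaging over an involutive symmetry of the domain\<close>

definition sym_mean :: "('a \<Rightarrow> 'a) \<Rightarrow> ('a \<Rightarrow> real) \<Rightarrow> 'a \<Rightarrow> real" where
  "sym_mean g u x = (u x + u (g x)) / 2"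

text \<open>For a linear involution \<open>g\<close>, the second summand is the pushforward of the
  vector field \<open>v\<close> along \<open>g\<close>. This is the averaging dual to
  \<open>sym_mean\<close> under the pairing with the gradient.\<close>

definition sym_mean_field :: "('a \<Rightarrow> 'a) \<Rightarrow> ('a \<Rightarrow> 'a::real_vector) \<Rightarrow> 'a \<Rightarrow> 'a" where
  "sym_mean_field g v x = (1/2) *\<^sub>R (v x + g (v (g x)))"

locale involutive_symmetry =
  fixes \<Omega> :: "(real^'n::{finite,wellorder}) set" and g :: "real^'n::{finite,wellorder} \<Rightarrow> real^'n::_"
  assumes open_domain: "open \<Omega>" and bounded_domain: "bounded \<Omega>"
    and orthogonal: "orthogonal_transformation g"
    and involutive [simp]: "g (g x) = x"
    and maps_domain: "x \<in> \<Omega> \<Longrightarrow> g x \<in> \<Omega>"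
begin

lemma linear: "linear g"
  using orthogonal by (rule orthogonal_transformation_linear)

lemma bounded_linear: "bounded_linear g"
  using linear linear_conv_bounded_linear by blast

lemma norm_g [simp]: "norm (g x) = norm x"
  using orthogonal by (rule orthogonal_transformation_norm)

text \<open>The adjoint of an orthogonal map is its inverse, and the inverse of an involution is the
  involution itself.\<close>

lemma inner_g: "g x \<bullet> y = x \<bullet> g y"
proof -
  have "g x \<bullet> g (g y) = x \<bullet> g y"
    using orthogonal unfolding orthogonal_transformation_def by blast
  then show ?thesis by simp
qed

section \<open>Invariance of Lebesgue measure on the domain and change of variables\<close>

lemma domain_lmeasurable: "\<Omega> \<in> lmeasurable"
  by (rule lmeasurable_open[OF bounded_domain open_domain])

lemma domain_sets: "\<Omega> \<in> sets lebesgue"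
  using domain_lmeasurable by (rule fmeasurableD)

text \<open>Boundedness of \<Omega> gives every measurable subset finite measure, so the facts about
  orthogonal images of sets in \<open>lmeasurable\<close> apply to all of them.\<close>

lemma sets_lebesgue_on_domain: "A \<in> sets (lebesgue_on \<Omega>) \<longleftrightarrow> A \<subseteq> \<Omega> \<and> A \<in> lmeasurable"
proof -
  have "A \<subseteq> \<Omega> \<Longrightarrow> A \<in> sets lebesgue \<Longrightarrow> A \<in> lmeasurable"
    using bounded_domain bounded_set_imp_lmeasurable bounded_subset by blast
  then show ?thesis
    using domain_sets by (auto simp: sets_restrict_space_iff)
qed

text \<open>Turns the preimages in the definition of \<open>distr\<close> into images, whose measure
  is known for orthogonal maps.\<close>

lemma vimage_eq_image: "A \<subseteq> \<Omega> \<Longrightarrow> g -` A \<inter> \<Omega> = g ` A"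
  using maps_domain by (auto simp: image_iff subset_iff) (metis involutive)

lemma measurable_g: "g \<in> lebesgue_on \<Omega> \<rightarrow>\<^sub>M lebesgue_on \<Omega>"
proof (rule measurableI)
  fix A assume "A \<in> sets (lebesgue_on \<Omega>)"
  then have A: "A \<subseteq> \<Omega>" "A \<in> lmeasurable"
    by (auto simp: sets_lebesgue_on_domain)
  have "g ` A \<in> lmeasurable"
    by (rule measurable_orthogonal_image[OF orthogonal A(2)])
  moreover have "g ` A \<subseteq> \<Omega>"
    using A(1) maps_domain by blast
  ultimately show "g -` A \<inter> space (lebesgue_on \<Omega>) \<in> sets (lebesgue_on \<Omega>)"
    using vimage_eq_image[OF A(1)] by (simp add: sets_lebesgue_on_domain)
qed (use maps_domain in simp)

text \<open>An orthogonal map preserves the measure of images, and here images are preimages. The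
  rules for substituting \<open>g x\<close> in integrals and in almost-everywhere statements all
  follow from this identity.\<close>

lemma distr_g: "distr (lebesgue_on \<Omega>) (lebesgue_on \<Omega>) g = lebesgue_on \<Omega>"
proof (rule measure_eqI)
  fix A assume "A \<in> sets (distr (lebesgue_on \<Omega>) (lebesgue_on \<Omega>) g)"
  then have A: "A \<in> sets (lebesgue_on \<Omega>)" "A \<subseteq> \<Omega>" "A \<in> lmeasurable"
    by (auto simp: sets_lebesgue_on_domain)
  have gA: "g ` A \<in> lmeasurable" "g ` A \<subseteq> \<Omega>"
    using measurable_orthogonal_image[OF orthogonal A(3)] A(2) maps_domain by auto
  have "emeasure (distr (lebesgue_on \<Omega>) (lebesgue_on \<Omega>) g) A = emeasure (lebesgue_on \<Omega>) (g ` A)"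
    using vimage_eq_image[OF A(2)] by (simp add: emeasure_distr[OF measurable_g A(1)])
  also have "\<dots> = emeasure lebesgue (g ` A)"
    using gA domain_sets by (simp add: emeasure_restrict_space)
  also have "\<dots> = emeasure lebesgue A"
    using measure_orthogonal_image[OF orthogonal A(3)] gA(1) A(3) by (simp add: emeasure_eq_measure2)
  also have "\<dots> = emeasure (lebesgue_on \<Omega>) A"
    using A domain_sets by (simp add: emeasure_restrict_space)
  finally show "emeasure (distr (lebesgue_on \<Omega>) (lebesgue_on \<Omega>) g) A = emeasure (lebesgue_on \<Omega>) A" .
qed simp

lemma integrable_comp:
  fixes F :: "(real,'n) vec \<Rightarrow> 'b::{banach, second_countable_topology}"
  shows "integrable (lebesgue_on \<Omega>) F \<Longrightarrow> integrable (lebesgue_on \<Omega>) (\<lambda>x. F (g x))"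
  using integrable_distr[OF measurable_g, of F] by (simp add: distr_g)

lemma integral_comp:
  fixes F :: "(real,'n) vec \<Rightarrow> 'b::{banach, second_countable_topology}"
  shows "F \<in> borel_measurable (lebesgue_on \<Omega>) \<Longrightarrow>
    (\<integral>x. F (g x) \<partial>lebesgue_on \<Omega>) = (\<integral>x. F x \<partial>lebesgue_on \<Omega>)"
  using integral_distr[OF measurable_g, of F] by (simp add: distr_g)

lemma nn_integral_comp:
  "F \<in> borel_measurable (lebesgue_on \<Omega>) \<Longrightarrow>
    (\<integral>\<^sup>+x. F (g x) \<partial>lebesgue_on \<Omega>) = (\<integral>\<^sup>+x. F x \<partial>lebesgue_on \<Omega>)"
  using nn_integral_distr[OF measurable_g, of F] by (simp add: distr_g)

lemma AE_comp: "AE x in lebesgue_on \<Omega>. P x \<Longrightarrow> AE x in lebesgue_on \<Omega>. P (g x)"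
  using AE_distrD[OF measurable_g, unfolded distr_g] .

section \<open>Duality between averaging functions and averaging fields\<close>

lemma test_field_conj: "test_field \<Omega> v \<Longrightarrow> test_field \<Omega> (\<lambda>x. g (v (g x)))"
  by (rule test_field_compose_linear[OF _ bounded_linear bounded_linear]) (auto intro: maps_domain)

lemma test_field_sym_mean_field:
  assumes "test_field \<Omega> v"
  shows "test_field \<Omega> (sym_mean_field g v)"
proof -
  have "test_field \<Omega> (\<lambda>x. (1/2) *\<^sub>R (v x + g (v (g x))))"
    by (rule test_field_compose_linear[OF test_field_add[OF assms test_field_conj[OF assms]]
        bounded_linear_scaleR_right bounded_linear_ident]) auto
  then show ?thesis
    by (simp add: sym_mean_field_def[abs_def])
qed

lemma norm_sym_mean_field_le:
  assumes "\<And>x. norm (v x) \<le> 1"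
  shows "norm (sym_mean_field g v x) \<le> 1"
proof -
  have "norm (v x + g (v (g x))) \<le> norm (v x) + norm (g (v (g x)))"
    by (rule norm_triangle_ineq)
  also have "\<dots> \<le> 2"
    using assms[of x] assms[of "g x"] by simp
  finally show ?thesis
    by (simp add: sym_mean_field_def)
qed

text \<open>By the chain rule the derivative of the conjugated field is the derivative
  \<open>?D\<close> at \<open>g x\<close> multiplied by the matrix of \<open>g\<close> on both
  sides. Cyclicity of the trace brings these two factors together, and their product is the
  identity.\<close>

lemma divergence_conj:
  assumes v: "test_field \<Omega> v"
  shows "divergence (\<lambda>x. g (v (g x))) x = divergence v (g x)"
proof -
  let ?D = "frechet_derivative v (at (g x))"
  have D: "(v has_derivative ?D) (at (g x))"
    using v by (rule test_field_has_derivative)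
  then have "((\<lambda>x. v (g x)) has_derivative (\<lambda>h. ?D (g h))) (at x)"
    using has_derivative_compose bounded_linear_imp_has_derivative[OF bounded_linear] by fast
  then have d: "((\<lambda>x. g (v (g x))) has_derivative (\<lambda>h. g (?D (g h)))) (at x)"
    by (rule bounded_linear.has_derivative[OF bounded_linear])
  have lin: "linear ?D"
    using D by (rule has_derivative_linear)
  have gg: "matrix g ** matrix g = mat 1"
    using matrix_compose[OF linear linear] by (simp add: o_def matrix_id_mat_1[unfolded id_def])
  have "matrix (\<lambda>h. g (?D (g h))) = matrix g ** (matrix ?D ** matrix g)"
    using matrix_compose[OF linear_compose[OF linear lin] linear] matrix_compose[OF linear lin]
    by (simp add: o_def)
  then have "trace (matrix (\<lambda>h. g (?D (g h)))) = trace (matrix ?D ** (matrix g ** matrix g))"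
    using trace_mul_sym[of "matrix g" "matrix ?D ** matrix g"] by (simp add: matrix_mul_assoc)
  then have "trace (matrix (\<lambda>h. g (?D (g h)))) = trace (matrix ?D)"
    by (simp add: gg)
  then show ?thesis
    using divergence_has_derivative[OF d] divergence_has_derivative[OF D] by simp
qed

lemma divergence_sym_mean_field:
  assumes v: "test_field \<Omega> v"
  shows "divergence (sym_mean_field g v) x = (divergence v x + divergence v (g x)) / 2"
proof -
  let ?D = "frechet_derivative v (at x)" and ?E = "frechet_derivative (\<lambda>x. g (v (g x))) (at x)"
  note D = test_field_has_derivative[OF v, of x]
  note E = test_field_has_derivative[OF test_field_conj[OF v], of x]
  have "(sym_mean_field g v has_derivative (\<lambda>h. (1/2) *\<^sub>R (?D h + ?E h))) (at x)"
    unfolding sym_mean_field_def[abs_def] by (intro derivative_intros D E)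
  then have "divergence (sym_mean_field g v) x = trace (matrix (\<lambda>h. (1/2) *\<^sub>R (?D h + ?E h)))"
    by (rule divergence_has_derivative)
  also have "\<dots> = (trace (matrix ?D) + trace (matrix ?E)) / 2"
    by (simp add: trace_def matrix_def sum.distrib sum_divide_distrib[symmetric])
  finally show ?thesis
    using divergence_has_derivative[OF D] divergence_has_derivative[OF E] divergence_conj[OF v] by simp
qed

text \<open>The divergence of the averaged field is the average of the divergence; substituting
  \<open>g x\<close> then moves the reflection from the divergence onto \<open>u\<close>.\<close>

lemma grad_dist_sym_mean:
  assumes u: "integrable (lebesgue_on \<Omega>) u" and v: "test_field \<Omega> v"
  shows "grad_dist \<Omega> (sym_mean g u) v = grad_dist \<Omega> u (sym_mean_field g v)"
proof -
  have int1: "integrable (lebesgue_on \<Omega>) (\<lambda>x. u x * divergence v x)"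
    by (rule integrable_mult_divergence[OF u v bounded_domain domain_sets])
  have int2: "integrable (lebesgue_on \<Omega>) (\<lambda>x. u (g x) * divergence v x)"
    by (rule integrable_mult_divergence[OF integrable_comp[OF u] v bounded_domain domain_sets])
  \<comment> \<open>Substituting \<open>g x\<close> in \<open>int2\<close> gives this, because
    \<open>g (g x)\<close> cancels in the argument of \<open>u\<close>.\<close>
  have int3: "integrable (lebesgue_on \<Omega>) (\<lambda>x. u x * divergence v (g x))"
    using integrable_comp[OF int2] by simp
  have "(\<integral>x. u x * divergence v (g x) \<partial>lebesgue_on \<Omega>) = (\<integral>x. u (g x) * divergence v x \<partial>lebesgue_on \<Omega>)"
    using integral_comp[OF borel_measurable_integrable[OF int3]] by simp
  then show ?thesis
    using int1 int2 int3
    by (simp add: grad_dist_divergence divergence_sym_mean_field[OF v] sym_mean_def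
        distrib_left distrib_right add_divide_distrib)
qed

text \<open>Averaging of fields is self-adjoint because \<open>g\<close> is self-adjoint and
  preserves the measure. This lets the average be moved from a test field onto an element of
  \<open>KerE\<close>.\<close>

lemma integral_inner_sym_mean_field:
  assumes w: "integrable (lebesgue_on \<Omega>) w" and v: "test_field \<Omega> v"
  shows "(\<integral>x. w x \<bullet> sym_mean_field g v x \<partial>lebesgue_on \<Omega>)
    = (\<integral>x. sym_mean_field g w x \<bullet> v x \<partial>lebesgue_on \<Omega>)"
proof -
  note cont = test_field_continuous[OF v]
  have int1: "integrable (lebesgue_on \<Omega>) (\<lambda>x. w x \<bullet> v x)"
    by (rule integrable_inner_continuous[OF w cont bounded_domain domain_sets])
  have int2: "integrable (lebesgue_on \<Omega>) (\<lambda>x. g (w (g x)) \<bullet> v x)"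
    by (rule integrable_inner_continuous[OF integrable_bounded_linear[OF bounded_linear integrable_comp[OF w]]
          cont bounded_domain domain_sets])
  have int3: "integrable (lebesgue_on \<Omega>) (\<lambda>x. w x \<bullet> g (v (g x)))"
    using integrable_comp[OF int2] by (simp add: inner_g)
  have "(\<integral>x. w x \<bullet> g (v (g x)) \<partial>lebesgue_on \<Omega>) = (\<integral>x. g (w (g x)) \<bullet> v x \<partial>lebesgue_on \<Omega>)"
    using integral_comp[OF borel_measurable_integrable[OF int3]] by (simp add: inner_g)
  then show ?thesis
    using int1 int2 int3 by (simp add: sym_mean_field_def inner_add_left inner_add_right add_divide_distrib)
qed

section \<open>Stability of BV under averaging\<close>

lemma is_finite_radon_measure_conj:
  assumes "is_finite_radon_measure \<Omega> T"
  shows "is_finite_radon_measure \<Omega> (\<lambda>v. T (\<lambda>x. g (v (g x))))"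
proof -
  obtain \<mu> \<sigma> where \<mu>: "finite_measure \<mu>" "sets \<mu> = sets (restrict_space borel \<Omega>)" "integrable \<mu> \<sigma>"
    and T: "\<And>v. test_field \<Omega> v \<Longrightarrow> T v = (\<integral>x. \<sigma> x \<bullet> v x \<partial>\<mu>)"
    using assms unfolding is_finite_radon_measure_def by blast
  have gb: "g \<in> borel_measurable borel"
    using linear_continuous_on[OF bounded_linear] by (rule borel_measurable_continuous_onI)
  then have "g \<in> restrict_space borel \<Omega> \<rightarrow>\<^sub>M restrict_space borel \<Omega>"
    by (rule measurable_restrict_space3) (use maps_domain in auto)
  then have g\<mu>: "g \<in> \<mu> \<rightarrow>\<^sub>M \<mu>"
    using measurable_cong_sets[OF \<mu>(2) \<mu>(2)] by blast
  \<comment> \<open>The measure is pushed forward by \<open>g\<close> and the density is conjugated;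
    substitution and self-adjointness of \<open>g\<close> then return the pairing of
    \<open>\<sigma>\<close> with the conjugated test field.\<close>
  let ?\<nu> = "distr \<mu> \<mu> g" and ?\<tau> = "\<lambda>x. g (\<sigma> (g x))"
  have [measurable]: "\<sigma> \<in> borel_measurable \<mu>"
    using \<mu>(3) by auto
  note [measurable] = g\<mu> gb
  have "finite_measure ?\<nu>"
    using \<mu>(1) g\<mu> by (rule finite_measure.finite_measure_distr)
  moreover have "integrable ?\<nu> ?\<tau>"
    using integrable_bounded_linear[OF bounded_linear \<mu>(3)] by (subst integrable_distr_eq[OF g\<mu>]) auto
  moreover have "T (\<lambda>x. g (v (g x))) = (\<integral>x. ?\<tau> x \<bullet> v x \<partial>?\<nu>)" if v: "test_field \<Omega> v" for v
  proof -
    have [measurable]: "v \<in> borel_measurable \<mu>"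
      by (rule test_field_borel_measurable[OF v \<mu>(2)])
    have "(\<integral>x. ?\<tau> x \<bullet> v x \<partial>?\<nu>) = (\<integral>x. ?\<tau> (g x) \<bullet> v (g x) \<partial>\<mu>)"
      by (rule integral_distr[OF g\<mu>]) measurable
    then show ?thesis
      using T[OF test_field_conj[OF v]] by (simp add: inner_g)
  qed
  ultimately show ?thesis
    unfolding is_finite_radon_measure_def using \<mu>(2) by (intro exI[of _ ?\<nu>] exI[of _ ?\<tau>]) auto
qed

lemma integrable_sym_mean:
  "integrable (lebesgue_on \<Omega>) u \<Longrightarrow> integrable (lebesgue_on \<Omega>) (sym_mean g u)"
  using integrable_comp[of u] by (simp add: sym_mean_def[abs_def])

lemma integrable_sym_mean_field:
  "integrable (lebesgue_on \<Omega>) w \<Longrightarrow> integrable (lebesgue_on \<Omega>) (sym_mean_field g w)"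
  using integrable_bounded_linear[OF bounded_linear integrable_comp[of w]]
  by (simp add: sym_mean_field_def[abs_def])

text \<open>This form exhibits the gradient of the average as a linear combination of two finite
  Radon measures, to which the closure properties apply.\<close>

lemma grad_dist_sym_mean_split:
  assumes u: "integrable (lebesgue_on \<Omega>) u" and v: "test_field \<Omega> v"
  shows "grad_dist \<Omega> (sym_mean g u) v
    = 1/2 * grad_dist \<Omega> u v + 1/2 * grad_dist \<Omega> u (\<lambda>x. g (v (g x)))"
proof -
  have int1: "integrable (lebesgue_on \<Omega>) (\<lambda>x. u x * divergence v x)"
    by (rule integrable_mult_divergence[OF u v bounded_domain domain_sets])
  have int2: "integrable (lebesgue_on \<Omega>) (\<lambda>x. u x * divergence (\<lambda>x. g (v (g x))) x)"
    by (rule integrable_mult_divergence[OF u test_field_conj[OF v] bounded_domain domain_sets])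
  show ?thesis
    using int1 int2 unfolding grad_dist_sym_mean[OF u v]
    by (simp add: grad_dist_divergence divergence_sym_mean_field[OF v] divergence_conj[OF v]
        distrib_left add_divide_distrib)
qed

lemma sym_mean_BV:
  assumes "u \<in> BV \<Omega>"
  shows "sym_mean g u \<in> BV \<Omega>"
proof -
  have u: "integrable (lebesgue_on \<Omega>) u" "is_finite_radon_measure \<Omega> (grad_dist \<Omega> u)"
    using assms by (auto simp: BV_def)
  have "is_finite_radon_measure \<Omega>
      (\<lambda>v. 1/2 * grad_dist \<Omega> u v + 1/2 * grad_dist \<Omega> u (\<lambda>x. g (v (g x))))"
    by (intro is_finite_radon_measure_add is_finite_radon_measure_scale is_finite_radon_measure_conj u(2))
  then have "is_finite_radon_measure \<Omega> (grad_dist \<Omega> (sym_mean g u))"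
    by (rule is_finite_radon_measure_cong[rotated]) (simp add: grad_dist_sym_mean_split[OF u(1)])
  then show ?thesis
    using integrable_sym_mean[OF u(1)] by (simp add: BV_def)
qed

lemma sym_mean_AE_cong:
  assumes "AE x in lebesgue_on \<Omega>. u x = u' x"
  shows "AE x in lebesgue_on \<Omega>. sym_mean g u x = sym_mean g u' x"
  using assms AE_comp[OF assms] by eventually_elim (simp add: sym_mean_def)

lemma sym_mean_AE_eq:
  assumes "AE x in lebesgue_on \<Omega>. u (g x) = u x"
  shows "AE x in lebesgue_on \<Omega>. sym_mean g u x = u x"
  using assms by eventually_elim (simp add: sym_mean_def)

end

section \<open>The fidelity term\<close>

text \<open>The mean value theorem on the two halves of the interval compares the increments of the
  power through its derivative at \<open>y < z\<close>. That derivative is nondecreasing for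
  \<open>p \<ge> 1\<close> and strictly increasing for \<open>p > 1\<close>.\<close>

lemma powr_midpoint:
  fixes a b p :: real
  assumes "1 \<le> p" and "0 \<le> a" and "a < b"
  shows "2 * ((a + b) / 2) powr p \<le> a powr p + b powr p" (is "?le")
    and "1 < p \<Longrightarrow> 2 * ((a + b) / 2) powr p < a powr p + b powr p"
proof -
  let ?m = "(a + b) / 2" and ?d = "\<lambda>x h. p * x powr (p - 1) * h"
  have cont: "continuous_on S (\<lambda>x. x powr p)" if "S \<subseteq> {0..}" for S
    using that assms(1) by (intro continuous_on_powr') (auto intro: continuous_intros)
  \<comment> \<open>Positive points suffice even if \<open>a = 0\<close>: the mean value theorem
    asks for derivatives only in the open interval.\<close>
  have deriv: "((\<lambda>x. x powr p) has_derivative ?d x) (at x)" if "0 < x" for x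
    using has_real_derivative_powr[OF that, of p] by (simp add: has_field_derivative_def)
  obtain y where y: "a < y" "y < ?m" "?m powr p - a powr p = ?d y (?m - a)"
  proof (rule mvt[of a ?m "\<lambda>x. x powr p" ?d])
    show "continuous_on {a..?m} (\<lambda>x. x powr p)"
      using assms by (intro cont) auto
  qed (use assms deriv in auto)
  obtain z where z: "?m < z" "z < b" "b powr p - ?m powr p = ?d z (b - ?m)"
  proof (rule mvt[of ?m b "\<lambda>x. x powr p" ?d])
    show "continuous_on {?m..b} (\<lambda>x. x powr p)"
      using assms by (intro cont) auto
  qed (use assms deriv in auto)
  have yz: "0 < y" "y < z" and h: "b - ?m = (b - a) / 2" "?m - a = (b - a) / 2" "0 < (b - a) / 2"
    using y z assms by (auto simp: field_simps)
  have gap: "a powr p + b powr p - 2 * ?m powr p = ?d z ((b - a) / 2) - ?d y ((b - a) / 2)"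
    using y(3) z(3) unfolding h by simp
  have "y powr (p - 1) \<le> z powr (p - 1)"
    using yz assms(1) by (intro powr_mono2) auto
  then have "?d y ((b - a) / 2) \<le> ?d z ((b - a) / 2)"
    using h(3) assms(1) by (intro mult_right_mono mult_left_mono) auto
  then show ?le
    using gap by simp
  show "2 * ?m powr p < a powr p + b powr p" if "1 < p"
  proof -
    have "y powr (p - 1) < z powr (p - 1)"
      using yz that by (intro powr_less_mono2) auto
    then have "?d y ((b - a) / 2) < ?d z ((b - a) / 2)"
      using h(3) that by (intro mult_strict_right_mono mult_strict_left_mono) auto
    then show ?thesis
      using gap by simp
  qed
qed

text \<open>The triangle inequality reduces to absolute values. Strictness survives when these
  coincide: then \<open>b = - a\<close>, so the left side is zero while
  \<open>a \<noteq> 0\<close>.\<close>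

lemma abs_midpoint_powr:
  fixes a b p :: real
  assumes "1 \<le> p"
  shows "\<bar>(a + b) / 2\<bar> powr p \<le> (\<bar>a\<bar> powr p + \<bar>b\<bar> powr p) / 2" (is ?le)
    and "1 < p \<Longrightarrow> a \<noteq> b \<Longrightarrow> \<bar>(a + b) / 2\<bar> powr p < (\<bar>a\<bar> powr p + \<bar>b\<bar> powr p) / 2"
proof -
  let ?m = "(\<bar>a\<bar> + \<bar>b\<bar>) / 2"
  have "\<bar>(a + b) / 2\<bar> \<le> ?m"
    by (simp add: abs_triangle_ineq)
  then have tri: "\<bar>(a + b) / 2\<bar> powr p \<le> ?m powr p"
    using assms by (intro powr_mono2) auto
  have mid: "?m powr p \<le> (\<bar>a\<bar> powr p + \<bar>b\<bar> powr p) / 2"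
    using powr_midpoint(1)[OF assms, of "\<bar>a\<bar>" "\<bar>b\<bar>"] powr_midpoint(1)[OF assms, of "\<bar>b\<bar>" "\<bar>a\<bar>"]
    by (cases "\<bar>a\<bar>" "\<bar>b\<bar>" rule: linorder_cases) (auto simp: add.commute)
  show ?le
    using tri mid by simp
  show "\<bar>(a + b) / 2\<bar> powr p < (\<bar>a\<bar> powr p + \<bar>b\<bar> powr p) / 2" if "1 < p" "a \<noteq> b"
  proof (cases "\<bar>a\<bar> = \<bar>b\<bar>")
    case True
    then have "b = - a" "a \<noteq> 0"
      using that(2) by (auto simp: abs_eq_iff)
    then show ?thesis
      by simp
  next
    case False
    then have "?m powr p < (\<bar>a\<bar> powr p + \<bar>b\<bar> powr p) / 2"
      using powr_midpoint(2)[OF assms, of "\<bar>a\<bar>" "\<bar>b\<bar>"] powr_midpoint(2)[OF assms, of "\<bar>b\<bar>" "\<bar>a\<bar>"] that(1)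
      by (cases "\<bar>a\<bar>" "\<bar>b\<bar>" rule: linorder_cases) (auto simp: add.commute)
    then show ?thesis
      using tri by simp
  qed
qed

lemma fidelity_AE_cong:
  assumes "AE x in lebesgue_on \<Omega>. u x = u' x"
  shows "fidelity \<Omega> p f u = fidelity \<Omega> p f u'"
proof -
  have "(\<integral>\<^sup>+x. ennreal (\<bar>f x - u x\<bar> powr p) \<partial>lebesgue_on \<Omega>)
      = (\<integral>\<^sup>+x. ennreal (\<bar>f x - u' x\<bar> powr p) \<partial>lebesgue_on \<Omega>)"
    by (rule nn_integral_cong_AE) (use assms in eventually_elim, simp)
  then show ?thesis
    by (simp add: fidelity_def)
qed

lemma fidelity_same: "fidelity \<Omega> p f f = 0"
  by (simp add: fidelity_def)

context involutive_symmetry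
begin

text \<open>Invariance of \<open>f\<close> makes the residual of the mean the midpoint of the
  residual of \<open>u\<close> and its reflection. These two have the same integrated power, so
  convexity gives the bound and strict convexity its equality case.\<close>

lemma fidelity_sym_mean:
  assumes p: "1 \<le> p" and f: "AE x in lebesgue_on \<Omega>. f (g x) = f x"
    and [measurable]: "f \<in> borel_measurable (lebesgue_on \<Omega>)" "u \<in> borel_measurable (lebesgue_on \<Omega>)"
  shows "fidelity \<Omega> p f (sym_mean g u) \<le> fidelity \<Omega> p f u" (is ?le)
    and "\<lbrakk>1 < p; fidelity \<Omega> p f u < \<infinity>; fidelity \<Omega> p f (sym_mean g u) = fidelity \<Omega> p f u\<rbrakk>
      \<Longrightarrow> AE x in lebesgue_on \<Omega>. sym_mean g u x = u x"
proof -
  let ?F = "\<lambda>x. \<bar>f x - u x\<bar> powr p" and ?H = "\<lambda>x. \<bar>f x - sym_mean g u x\<bar> powr p"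
  let ?M = "\<lambda>x. (?F x + ?F (g x)) / 2"
  note [measurable] = measurable_g
  have [measurable]: "sym_mean g u \<in> borel_measurable (lebesgue_on \<Omega>)"
    unfolding sym_mean_def[abs_def] by measurable
  have half: "ennreal ((s + t) / 2) = ennreal (1/2) * (ennreal s + ennreal t)" if "0 \<le> s" "0 \<le> t" for s t
    using ennreal_mult[of "1/2" "s + t"] ennreal_plus[OF that] that by simp
  have "(\<integral>\<^sup>+x. ennreal (?M x) \<partial>lebesgue_on \<Omega>)
      = (\<integral>\<^sup>+x. ennreal (1/2) * (ennreal (?F x) + ennreal (?F (g x))) \<partial>lebesgue_on \<Omega>)"
    by (intro nn_integral_cong half) auto
  also have "\<dots> = ennreal (1/2) * ((\<integral>\<^sup>+x. ennreal (?F x) \<partial>lebesgue_on \<Omega>)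
      + (\<integral>\<^sup>+x. ennreal (?F (g x)) \<partial>lebesgue_on \<Omega>))"
    by (simp add: nn_integral_cmult nn_integral_add)
  also have "(\<integral>\<^sup>+x. ennreal (?F (g x)) \<partial>lebesgue_on \<Omega>) = (\<integral>\<^sup>+x. ennreal (?F x) \<partial>lebesgue_on \<Omega>)"
    by (rule nn_integral_comp) measurable
  also have "ennreal (1/2) * (I + I) = I" for I
  proof -
    have "ennreal (1/2) * 2 = ennreal (1/2 * 2)"
      by (subst ennreal_mult) auto
    then show ?thesis
      by (simp add: mult_2[symmetric] mult.assoc[symmetric])
  qed
  finally have M: "(\<integral>\<^sup>+x. ennreal (?M x) \<partial>lebesgue_on \<Omega>) = (\<integral>\<^sup>+x. ennreal (?F x) \<partial>lebesgue_on \<Omega>)" .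
  \<comment> \<open>The second residual is written with \<open>f x\<close>, so the identity holds
    everywhere; it agrees with the reflected residual only almost everywhere, by
    \<open>f\<close>.\<close>
  have mid: "f x - sym_mean g u x = ((f x - u x) + (f x - u (g x))) / 2" for x
    by (simp add: sym_mean_def field_simps)
  have HM: "AE x in lebesgue_on \<Omega>. ?H x \<le> ?M x"
    using f
  proof eventually_elim
    case (elim x)
    show ?case
      using abs_midpoint_powr(1)[OF p, of "f x - u x" "f x - u (g x)"] unfolding mid elim .
  qed
  then have "(\<integral>\<^sup>+x. ennreal (?H x) \<partial>lebesgue_on \<Omega>) \<le> (\<integral>\<^sup>+x. ennreal (?M x) \<partial>lebesgue_on \<Omega>)"
    by (intro nn_integral_mono_AE) (auto intro: ennreal_leI)
  then show ?le
    unfolding M fidelity_def by (rule mult_left_mono) simp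
  show "AE x in lebesgue_on \<Omega>. sym_mean g u x = u x"
    if "1 < p" and fin: "fidelity \<Omega> p f u < \<infinity>" and eq: "fidelity \<Omega> p f (sym_mean g u) = fidelity \<Omega> p f u"
  proof -
    have pos: "ennreal (1 / p) \<noteq> 0" "ennreal (1 / p) \<noteq> top"
      using p by auto
    have HF: "(\<integral>\<^sup>+x. ennreal (?H x) \<partial>lebesgue_on \<Omega>) = (\<integral>\<^sup>+x. ennreal (?F x) \<partial>lebesgue_on \<Omega>)"
      using eq pos unfolding fidelity_def by (simp add: ennreal_mult_cancel_left)
    have finH: "(\<integral>\<^sup>+x. ennreal (?H x) \<partial>lebesgue_on \<Omega>) \<noteq> \<infinity>"
      using fin pos unfolding HF fidelity_def by (auto simp: ennreal_mult_less_top less_top)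
    \<comment> \<open>\<open>?H\<close> lies below \<open>?M\<close> almost everywhere and both have
      the same finite integral, so the reverse inequality must hold almost everywhere too.\<close>
    have "AE x in lebesgue_on \<Omega>. ennreal (?M x) \<le> ennreal (?H x)"
    proof (rule ccontr)
      assume "\<not> ?thesis"
      then have "(\<integral>\<^sup>+x. ennreal (?H x) \<partial>lebesgue_on \<Omega>) < (\<integral>\<^sup>+x. ennreal (?M x) \<partial>lebesgue_on \<Omega>)"
        using HM finH by (intro nn_integral_less) (auto intro: ennreal_leI elim!: eventually_mono)
      then show False
        using M HF by simp
    qed
    then have "AE x in lebesgue_on \<Omega>. ?M x \<le> ?H x"
      by eventually_elim (simp add: ennreal_le_iff)
    then have "AE x in lebesgue_on \<Omega>. u (g x) = u x"
      using f
    proof eventually_elim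
      case (elim x)
      \<comment> \<open>Equality in the midpoint inequality is incompatible with two different
        residuals when \<open>p > 1\<close>, hence \<open>u x = u (g x)\<close>.\<close>
      have "\<not> ?H x < (\<bar>f x - u x\<bar> powr p + \<bar>f x - u (g x)\<bar> powr p) / 2"
        using elim by simp
      then show ?case
        using abs_midpoint_powr(2)[OF p \<open>1 < p\<close>, of "f x - u x" "f x - u (g x)"] unfolding mid
        by (cases "u x = u (g x)") auto
    qed
    then show ?thesis
      by (rule sym_mean_AE_eq)
  qed
qed

end

section \<open>Symmetries of the square\<close>

definition refl\<^sub>1 :: "real^2 \<Rightarrow> real^2" where "refl\<^sub>1 x = vector [- x $ 1, x $ 2]"
definition refl\<^sub>2 :: "real^2 \<Rightarrow> real^2" where "refl\<^sub>2 x = vector [x $ 1, - x $ 2]"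
definition swap :: "real^2 \<Rightarrow> real^2" where "swap x = vector [x $ 2, x $ 1]"
definition quarter_turn :: "real^2 \<Rightarrow> real^2" where "quarter_turn x = vector [- x $ 2, x $ 1]"

lemmas sym_defs = refl\<^sub>1_def refl\<^sub>2_def swap_def quarter_turn_def

lemma sym_nth [simp]:
  "refl\<^sub>1 x $ 1 = - x $ 1" "refl\<^sub>1 x $ 2 = x $ 2" "refl\<^sub>2 x $ 1 = x $ 1" "refl\<^sub>2 x $ 2 = - x $ 2"
  "swap x $ 1 = x $ 2" "swap x $ 2 = x $ 1" "quarter_turn x $ 1 = - x $ 2" "quarter_turn x $ 2 = x $ 1"
  by (simp_all add: sym_defs)

lemma orthogonal_syms:
  "orthogonal_transformation refl\<^sub>1" "orthogonal_transformation refl\<^sub>2" "orthogonal_transformation swap"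
  by (auto simp: orthogonal_transformation_def vec_eq_iff forall_2 inner_vec_def sum_2 intro!: linearI)

text \<open>A centred square of any orientation has this symmetry, whereas the axis reflections
  depend on the tilt and come from the hypothesis on \<open>f\<close>.\<close>

lemma square_quarter_turn:
  assumes "centred_open_square \<Omega>" and "x \<in> \<Omega>"
  shows "quarter_turn x \<in> \<Omega>"
proof -
  obtain a R where R: "orthogonal_transformation R" and \<Omega>: "\<Omega> = R ` {x :: real^2. \<forall>i. \<bar>x $ i\<bar> < a}"
    using assms(1) unfolding centred_open_square_def by blast
  obtain q :: "real^2" where q: "\<And>i. \<bar>q $ i\<bar> < a" and x: "x = R q"
    using assms(2) \<Omega> by blast
  have lin: "linear R"
    using R by (rule orthogonal_transformation_linear)
  define P N where "P = R (axis 1 1)" and "N = R (axis 2 1)"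
  have expand: "R y = (y $ 1) *\<^sub>R P + (y $ 2) *\<^sub>R N" for y
  proof -
    have "y = (y $ 1) *\<^sub>R axis 1 1 + (y $ 2) *\<^sub>R axis 2 1"
      by (simp add: vec_eq_iff forall_2 axis_def)
    then have "R y = R ((y $ 1) *\<^sub>R axis 1 1 + (y $ 2) *\<^sub>R axis 2 1)"
      by simp
    then show ?thesis
      by (simp add: P_def N_def linear_add[OF lin] linear_scale[OF lin])
  qed
  have inner_R: "R v \<bullet> R w = v \<bullet> w" for v w
    using R by (simp add: orthogonal_transformation_def)
  define c s d e where "c = P $ 1" and "s = P $ 2" and "d = N $ 1" and "e = N $ 2"
  have on: "c * c + s * s = 1" "d * d + e * e = 1" "c * d + s * e = 0"
    using inner_R[of "axis 1 1" "axis 1 1"] inner_R[of "axis 2 1" "axis 2 1"]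
      inner_R[of "axis 1 1" "axis 2 1"]
    by (simp_all add: P_def N_def c_def s_def d_def e_def inner_vec_def sum_2 axis_def)
  \<comment> \<open>\<open>\<delta>\<close> is the determinant of \<open>R\<close>. The equations
    for \<open>d\<close> and \<open>e\<close> below say that the second column of \<open>R\<close>
    is \<open>\<delta>\<close> times the quarter turn of the first, so reflections are covered as
    well as rotations.\<close>
  define \<delta> where "\<delta> = c * e - s * d"
  have \<delta>\<delta>: "\<delta> * \<delta> = 1"
    using on unfolding \<delta>_def by algebra
  have d: "d = - (\<delta> * s)"
    using on unfolding \<delta>_def by algebra
  have e: "e = \<delta> * c"
    using on unfolding \<delta>_def by algebra
  have abs_\<delta>: "\<bar>\<delta>\<bar> = 1"
    using \<delta>\<delta> square_eq_1_iff[of \<delta>] by auto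
  \<comment> \<open>The quarter turn commutes with \<open>R\<close> up to the sign \<open>\<delta> = det R\<close>.\<close>
  have "quarter_turn x $ 1 = R (\<delta> *\<^sub>R quarter_turn q) $ 1"
    unfolding x expand sym_nth using \<delta>\<delta> d e
    by (simp add: c_def[symmetric] s_def[symmetric] d_def[symmetric] e_def[symmetric])
  moreover have "quarter_turn x $ 2 = R (\<delta> *\<^sub>R quarter_turn q) $ 2"
    unfolding x expand sym_nth using \<delta>\<delta> d e
    by (simp add: c_def[symmetric] s_def[symmetric] d_def[symmetric] e_def[symmetric])
  ultimately have "quarter_turn x = R (\<delta> *\<^sub>R quarter_turn q)"
    by (simp add: vec_eq_iff forall_2)
  moreover have "\<bar>(\<delta> *\<^sub>R quarter_turn q) $ i\<bar> < a" for i
    using q[of 1] q[of 2] abs_\<delta> exhaust_2[of i] by (auto simp: abs_mult)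
  ultimately show ?thesis
    unfolding \<Omega> by blast
qed

lemma open_bounded_square:
  assumes "centred_open_square \<Omega>"
  shows "open \<Omega>" "bounded \<Omega>"
proof -
  obtain a R where R: "orthogonal_transformation R" and \<Omega>: "\<Omega> = R ` {x :: real^2. \<forall>i. \<bar>x $ i\<bar> < a}"
    using assms unfolding centred_open_square_def by blast
  have "{x :: real^2. \<forall>i. \<bar>x $ i\<bar> < a} = box (\<chi> i. - a) (\<chi> i. a)"
    by (auto simp: mem_box_cart abs_less_iff) (metis minus_less_iff)+
  then have \<Omega>': "\<Omega> = R ` box (\<chi> i. - a) (\<chi> i. a)"
    using \<Omega> by simp
  show "open \<Omega>"
    unfolding \<Omega>' using open_box orthogonal_transformation_linear[OF R] orthogonal_transformation_surj[OF R]
    by (rule open_surjective_linear_image)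
  show "bounded \<Omega>"
    unfolding \<Omega>' using bounded_box orthogonal_transformation_linear[OF R] linear_conv_bounded_linear
    by (blast intro: bounded_linear_image)
qed

locale symmetric_square =
  s1: involutive_symmetry \<Omega> refl\<^sub>1 + s2: involutive_symmetry \<Omega> refl\<^sub>2 + sw: involutive_symmetry \<Omega> swap
  for \<Omega> :: "(real^2) set"

text \<open>The reflections preserve \<Omega> by assumption, and the swap is a quarter turn followed
  by a reflection.\<close>

lemma symmetric_squareI:
  assumes "centred_open_square \<Omega>" and "axes_symmetric \<Omega> f"
  shows "symmetric_square \<Omega>"
proof -
  have r: "refl\<^sub>1 x \<in> \<Omega>" "refl\<^sub>2 x \<in> \<Omega>" if "x \<in> \<Omega>" for x
    using assms(2) that by (auto simp: axes_symmetric_def sym_defs)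
  have "swap x \<in> \<Omega>" if "x \<in> \<Omega>" for x
  proof -
    have "swap x = refl\<^sub>1 (quarter_turn x)"
      by (simp add: vec_eq_iff forall_2)
    then show ?thesis
      using r(1) square_quarter_turn[OF assms(1) that] by simp
  qed
  then show ?thesis
    using open_bounded_square[OF assms(1)] r orthogonal_syms
    by unfold_locales (auto simp: vec_eq_iff forall_2)
qed

text \<open>Expanded, this is one eighth of the sum of \<open>u\<close> over the orbit under the
  dihedral group of order eight, counted with multiplicity: four products of the reflections, each
  with or without the swap.\<close>

definition square_mean :: "(real^2 \<Rightarrow> real) \<Rightarrow> real^2 \<Rightarrow> real" where
  "square_mean u = sym_mean swap (sym_mean refl\<^sub>2 (sym_mean refl\<^sub>1 u))"

text \<open>As rewrite rules these move the swap innermost and order the reflections, giving each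
  group element a normal form. Applying a symmetry then visibly permutes the eight summands of
  \<open>square_mean\<close>.\<close>

lemma syms_simps:
  "refl\<^sub>1 (refl\<^sub>1 x) = x" "refl\<^sub>2 (refl\<^sub>2 x) = x" "swap (swap x) = x"
  "refl\<^sub>2 (refl\<^sub>1 x) = refl\<^sub>1 (refl\<^sub>2 x)"
  "swap (refl\<^sub>1 x) = refl\<^sub>2 (swap x)" "swap (refl\<^sub>2 x) = refl\<^sub>1 (swap x)"
  "quarter_turn x = refl\<^sub>1 (swap x)" "refl\<^sub>1 (refl\<^sub>2 (refl\<^sub>1 x)) = refl\<^sub>2 x"
  by (simp_all add: vec_eq_iff forall_2)

lemma square_mean_refl\<^sub>1: "square_mean u (refl\<^sub>1 x) = square_mean u x"
  and square_mean_refl\<^sub>2: "square_mean u (refl\<^sub>2 x) = square_mean u x"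
  and square_mean_quarter_turn: "square_mean u (quarter_turn x) = square_mean u x"
  by (simp_all add: square_mean_def sym_mean_def syms_simps add_divide_distrib)

text \<open>A skew 2 by 2 matrix has only off-diagonal entries, whose sign flips under conjugation
  by \<open>refl\<^sub>1\<close>. The two components of \<open>b\<close> cancel under
  \<open>refl\<^sub>1\<close> and \<open>refl\<^sub>2\<close> respectively.\<close>

lemma KerE_symmetrised_zero:
  assumes "r \<in> KerE"
  shows "sym_mean_field swap (sym_mean_field refl\<^sub>2 (sym_mean_field refl\<^sub>1 r)) = (\<lambda>x. 0)"
proof -
  obtain A b where r: "r = (\<lambda>x. A *v x + b)" and A: "transpose A = - A"
    using assms unfolding KerE_def by blast
  have "A $ i $ j = - A $ j $ i" for i j
    using arg_cong[OF A, of "\<lambda>B. B $ j $ i"] by (simp add: transpose_def)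
  then have "A $ 1 $ 1 = 0" "A $ 2 $ 2 = 0" "A $ 2 $ 1 = - A $ 1 $ 2"
    by (metis equal_neg_zero)+
  then have "sym_mean_field refl\<^sub>2 (sym_mean_field refl\<^sub>1 r) = (\<lambda>x. 0)"
    by (simp add: fun_eq_iff r sym_mean_field_def vec_eq_iff forall_2 matrix_vector_mult_def sum_2)
  moreover have "sym_mean_field swap (\<lambda>x. 0) = (\<lambda>x. 0)"
    by (simp add: fun_eq_iff sym_mean_field_def vec_eq_iff forall_2)
  ultimately show ?thesis
    by simp
qed

section \<open>Comparison of the total variation and the total generalised variation\<close>

text \<open>Truncation at zero leaves only subadditivity, and this for reals of any sign. The
  pairings with a test field to which it is applied may be negative.\<close>

lemma ennreal_add_le: "ennreal (a + b) \<le> ennreal a + ennreal b"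
proof (cases "0 \<le> a \<and> 0 \<le> b")
  case True
  then show ?thesis by simp
next
  case False
  then have "a + b \<le> a \<or> a + b \<le> b"
    by auto
  then show ?thesis
    by (metis add.commute add_increasing2 ennreal_leI order_refl order_trans zero_le)
qed

lemma TV_AE_cong:
  assumes "u \<in> BV \<Omega>" and "u' \<in> BV \<Omega>" and "AE x in lebesgue_on \<Omega>. u x = u' x"
    and "open \<Omega>" "bounded \<Omega>"
  shows "TV \<Omega> u = TV \<Omega> u'"
proof -
  have "\<Omega> \<in> sets lebesgue"
    using assms(4) by (simp add: lmeasurable_open[OF assms(5)] fmeasurableD)
  then have int: "integrable (lebesgue_on \<Omega>) (\<lambda>x. w x * divergence v x)"
    if "test_field \<Omega> v" "w \<in> BV \<Omega>" for v w
    using that integrable_mult_divergence assms(5) by (auto simp: BV_def)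
  have "grad_dist \<Omega> u v = grad_dist \<Omega> u' v" if v: "test_field \<Omega> v" for v
  proof -
    have "(\<integral>x. u x * divergence v x \<partial>lebesgue_on \<Omega>) = (\<integral>x. u' x * divergence v x \<partial>lebesgue_on \<Omega>)"
      by (rule integral_cong_AE) (use assms(3) int[OF v] assms(1,2) in \<open>auto elim: eventually_mono\<close>)
    then show ?thesis
      by (simp add: grad_dist_divergence)
  qed
  then show ?thesis
    unfolding TV_def radon_norm_def by (auto intro!: SUP_cong)
qed

text \<open>The field \<open>w = 0\<close> is a competitor, and it turns the first term into the
  total variation and the second into zero.\<close>

lemma TGV2_le_TV: "TGV2 \<Omega> \<beta> \<alpha> u \<le> ennreal \<alpha> * TV \<Omega> u"
proof -
  have zero: "sym_grad_dist \<Omega> (\<lambda>x. 0) = (\<lambda>v. 0)" "field_dist \<Omega> (\<lambda>x. 0 :: real^'a) = (\<lambda>v. 0)"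
    by (simp_all add: fun_eq_iff sym_grad_dist_def field_dist_def)
  have "(\<lambda>x. 0) \<in> BD \<Omega>"
    by (simp add: BD_def zero is_finite_radon_measure_zero)
  then have "TGV2 \<Omega> \<beta> \<alpha> u \<le> ennreal \<alpha> * radon_norm \<Omega> (\<lambda>v. grad_dist \<Omega> u v - field_dist \<Omega> (\<lambda>x. 0) v)
      + ennreal \<beta> * radon_norm \<Omega> (sym_grad_dist \<Omega> (\<lambda>x. 0))"
    unfolding TGV2_def by (rule INF_lower)
  also have "radon_norm \<Omega> (sym_grad_dist \<Omega> (\<lambda>x. 0)) = 0"
    by (auto simp: radon_norm_def zero intro!: antisym SUP_least)
  finally show ?thesis
    by (simp add: zero TV_def)
qed

context symmetric_square
begin

lemma square_mean_BV: "u \<in> BV \<Omega> \<Longrightarrow> square_mean u \<in> BV \<Omega>"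
  unfolding square_mean_def by (intro sw.sym_mean_BV s2.sym_mean_BV s1.sym_mean_BV)

lemma TV_AE_eq:
  "u \<in> BV \<Omega> \<Longrightarrow> u' \<in> BV \<Omega> \<Longrightarrow> AE x in lebesgue_on \<Omega>. u x = u' x \<Longrightarrow> TV \<Omega> u = TV \<Omega> u'"
  using TV_AE_cong s1.open_domain s1.bounded_domain by blast

lemma TV_square_mean_le:
  assumes u: "u \<in> BV \<Omega>" and w: "w \<in> BD \<Omega>" and r: "r \<in> KerE"
  shows "TV \<Omega> (square_mean u) \<le> radon_norm \<Omega> (\<lambda>v. grad_dist \<Omega> u v - field_dist \<Omega> w v)
    + (\<integral>\<^sup>+x. ennreal (norm (w x - r x)) \<partial>lebesgue_on \<Omega>)"
proof -
  have ui: "integrable (lebesgue_on \<Omega>) u" and wi: "integrable (lebesgue_on \<Omega>) w"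
    using u w by (auto simp: BV_def BD_def)
  obtain A b where "r = (\<lambda>x. A *v x + b)"
    using r unfolding KerE_def by blast
  then have rc: "continuous_on S r" for S
    using continuous_on_add[OF linear_continuous_on[OF matrix_vector_mul_bounded_linear] continuous_on_const]
    by simp
  have "bounded (r ` closure \<Omega>)"
    using s1.bounded_domain by (intro compact_imp_bounded compact_continuous_image rc) simp
  then obtain B where B: "\<And>x. x \<in> closure \<Omega> \<Longrightarrow> norm (r x) \<le> B"
    unfolding bounded_pos by auto
  \<comment> \<open>An affine field is bounded on the compact closure of \<Omega>, and \<Omega> has
    finite measure.\<close>
  have ri: "integrable (lebesgue_on \<Omega>) r"
  proof (rule finite_measure.integrable_const_bound)
    show "finite_measure (lebesgue_on \<Omega>)"
      by (rule finite_measure_lebesgue_on[OF s1.domain_lmeasurable])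
    show "r \<in> borel_measurable (lebesgue_on \<Omega>)"
      using rc s1.domain_sets by (rule continuous_imp_measurable_on_sets_lebesgue)
    show "AE x in lebesgue_on \<Omega>. norm (r x) \<le> B"
      using B closure_subset[of \<Omega>] by (intro AE_I2) auto
  qed
  have "ennreal (grad_dist \<Omega> (square_mean u) v)
      \<le> radon_norm \<Omega> (\<lambda>v. grad_dist \<Omega> u v - field_dist \<Omega> w v)
        + (\<integral>\<^sup>+x. ennreal (norm (w x - r x)) \<partial>lebesgue_on \<Omega>)"
    if v: "test_field \<Omega> v" and v1: "\<And>x. norm (v x) \<le> 1" for v
  proof -
    \<comment> \<open>The outermost average of \<open>square_mean\<close> is transferred first and
      ends up innermost, so the order is reversed.\<close>
    define V where "V = sym_mean_field refl\<^sub>1 (sym_mean_field refl\<^sub>2 (sym_mean_field swap v))"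
    note tv = sw.test_field_sym_mean_field[OF v]
    note tv2 = s2.test_field_sym_mean_field[OF tv]
    have V: "test_field \<Omega> V" "\<And>x. norm (V x) \<le> 1"
      unfolding V_def using s1.test_field_sym_mean_field[OF tv2]
      by (auto intro!: s1.norm_sym_mean_field_le s2.norm_sym_mean_field_le sw.norm_sym_mean_field_le v1)
    have grad: "grad_dist \<Omega> (square_mean u) v = grad_dist \<Omega> u V"
      unfolding square_mean_def V_def
      by (simp add: sw.grad_dist_sym_mean[OF s2.integrable_sym_mean[OF s1.integrable_sym_mean[OF ui]] v]
          s2.grad_dist_sym_mean[OF s1.integrable_sym_mean[OF ui] tv] s1.grad_dist_sym_mean[OF ui tv2])
    \<comment> \<open>Self-adjointness moves the three averages from the test field back onto
      \<open>r\<close>, again reversing their order; the symmetrised \<open>r\<close>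
      vanishes.\<close>
    have rV: "(\<integral>x. r x \<bullet> V x \<partial>lebesgue_on \<Omega>) = 0"
    proof -
      have i1: "integrable (lebesgue_on \<Omega>) (sym_mean_field refl\<^sub>1 r)"
        by (rule s1.integrable_sym_mean_field[OF ri])
      have i2: "integrable (lebesgue_on \<Omega>) (sym_mean_field refl\<^sub>2 (sym_mean_field refl\<^sub>1 r))"
        by (rule s2.integrable_sym_mean_field[OF i1])
      show ?thesis
        unfolding V_def s1.integral_inner_sym_mean_field[OF ri tv2]
          s2.integral_inner_sym_mean_field[OF i1 tv] sw.integral_inner_sym_mean_field[OF i2 v]
          KerE_symmetrised_zero[OF r] by simp
    qed
    note int = integrable_inner_continuous[OF _ test_field_continuous[OF V(1)] s1.bounded_domain s1.domain_sets]
    \<comment> \<open>Since \<open>r\<close> pairs to zero with \<open>V\<close>, it can be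
      subtracted from \<open>w\<close> at no cost.\<close>
    have "field_dist \<Omega> w V = (\<integral>x. (w x - r x) \<bullet> V x \<partial>lebesgue_on \<Omega>)"
      using int[OF wi] int[OF ri] rV by (simp add: field_dist_def inner_diff_left)
    also have "\<dots> \<le> (\<integral>x. norm (w x - r x) \<partial>lebesgue_on \<Omega>)"
    proof (rule integral_mono)
      show "integrable (lebesgue_on \<Omega>) (\<lambda>x. (w x - r x) \<bullet> V x)"
        using int[of "\<lambda>x. w x - r x"] wi ri by simp
      show "(w x - r x) \<bullet> V x \<le> norm (w x - r x)" for x
        using norm_cauchy_schwarz[of "w x - r x" "V x"] V(2)[of x]
        by (meson mult_left_le norm_ge_zero order_trans)
    qed (use wi ri in auto)
    finally have "ennreal (field_dist \<Omega> w V) \<le> ennreal (\<integral>x. norm (w x - r x) \<partial>lebesgue_on \<Omega>)"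
      by (rule ennreal_leI)
    also have "\<dots> = (\<integral>\<^sup>+x. ennreal (norm (w x - r x)) \<partial>lebesgue_on \<Omega>)"
      using wi ri by (intro nn_integral_eq_integral[symmetric]) auto
    finally have le2: "ennreal (field_dist \<Omega> w V) \<le> (\<integral>\<^sup>+x. ennreal (norm (w x - r x)) \<partial>lebesgue_on \<Omega>)" .
    have le1: "ennreal (grad_dist \<Omega> u V - field_dist \<Omega> w V)
        \<le> radon_norm \<Omega> (\<lambda>v. grad_dist \<Omega> u v - field_dist \<Omega> w v)"
      unfolding radon_norm_def using V by (intro SUP_upper) auto
    have "ennreal (grad_dist \<Omega> u V) = ennreal ((grad_dist \<Omega> u V - field_dist \<Omega> w V) + field_dist \<Omega> w V)"
      by simp
    also have "\<dots> \<le> ennreal (grad_dist \<Omega> u V - field_dist \<Omega> w V) + ennreal (field_dist \<Omega> w V)"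
      by (rule ennreal_add_le)
    finally show ?thesis
      unfolding grad using add_mono[OF le1 le2] by (rule order_trans)
  qed
  then show ?thesis
    unfolding TV_def by (subst radon_norm_def) (auto intro!: SUP_least)
qed

text \<open>If \<open>r\<close> is the Sobolev--Korn projection of \<open>w\<close>, the error term in the preceding estimate is at most
  \<open>C \<parallel>\<E>w\<parallel>\<close>, which the assumption \<open>\<alpha> C \<le> \<beta>\<close> absorbs.\<close>

lemma TV_square_mean_le_TGV2:
  assumes u: "u \<in> BV \<Omega>" and C: "sobolev_korn_constant \<Omega> C" and "0 < \<alpha>" and "\<alpha> * C \<le> \<beta>"
  shows "ennreal \<alpha> * TV \<Omega> (square_mean u) \<le> TGV2 \<Omega> \<beta> \<alpha> u"
  unfolding TGV2_def
proof (rule INF_greatest)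
  fix w assume w: "w \<in> BD \<Omega>"
  let ?D = "radon_norm \<Omega> (\<lambda>v. grad_dist \<Omega> u v - field_dist \<Omega> w v)"
    and ?E = "radon_norm \<Omega> (sym_grad_dist \<Omega> w)"
  obtain r where r: "r \<in> KerE" "(\<integral>\<^sup>+x. ennreal (norm (w x - r x)) \<partial>lebesgue_on \<Omega>) \<le> ennreal C * ?E"
    using C w unfolding sobolev_korn_constant_def by blast
  have "C > 0"
    using C by (simp add: sobolev_korn_constant_def)
  have "TV \<Omega> (square_mean u) \<le> ?D + ennreal C * ?E"
    using TV_square_mean_le[OF u w r(1)] add_left_mono[OF r(2)] by (rule order_trans)
  then have "ennreal \<alpha> * TV \<Omega> (square_mean u) \<le> ennreal \<alpha> * (?D + ennreal C * ?E)"
    by (rule mult_left_mono) simp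
  also have "\<dots> = ennreal \<alpha> * ?D + ennreal (\<alpha> * C) * ?E"
    using \<open>0 < \<alpha>\<close> \<open>C > 0\<close> by (simp add: distrib_left ennreal_mult mult.assoc)
  also have "\<dots> \<le> ennreal \<alpha> * ?D + ennreal \<beta> * ?E"
    using assms(4) by (intro add_left_mono mult_right_mono ennreal_leI) auto
  finally show "ennreal \<alpha> * TV \<Omega> (square_mean u) \<le> ennreal \<alpha> * ?D + ennreal \<beta> * ?E" .
qed

section \<open>Invariant functions and the full group average\<close>

lemma symmetric_AE:
  assumes "axes_symmetric \<Omega> u" and "quarter_turn_invariant \<Omega> u"
  shows "AE x in lebesgue_on \<Omega>. u (refl\<^sub>1 x) = u x" "AE x in lebesgue_on \<Omega>. u (refl\<^sub>2 x) = u x"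
    "AE x in lebesgue_on \<Omega>. u (swap x) = u x"
proof -
  show 1: "AE x in lebesgue_on \<Omega>. u (refl\<^sub>1 x) = u x" and 2: "AE x in lebesgue_on \<Omega>. u (refl\<^sub>2 x) = u x"
    using assms(1) by (auto simp: axes_symmetric_def sym_defs eq_commute)
  have "AE x in lebesgue_on \<Omega>. u (quarter_turn x) = u x"
    using assms(2) by (simp add: quarter_turn_invariant_def sym_defs)
  \<comment> \<open>The swap is the quarter turn after \<open>refl\<^sub>2\<close>. The exceptional
    null set of the quarter-turn identity is carried along \<open>refl\<^sub>2\<close>, which
    preserves the measure.\<close>
  from s2.AE_comp[OF this] 2 show "AE x in lebesgue_on \<Omega>. u (swap x) = u x"
  proof eventually_elim
    case (elim x)
    have "quarter_turn (refl\<^sub>2 x) = swap x"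
      by (simp add: vec_eq_iff forall_2)
    then show ?case
      using elim by simp
  qed
qed

lemma square_mean_symmetric:
  "axes_symmetric \<Omega> (square_mean u)" "quarter_turn_invariant \<Omega> (square_mean u)"
  using s1.maps_domain s2.maps_domain
  by (simp_all add: axes_symmetric_def quarter_turn_invariant_def
      refl\<^sub>1_def[symmetric] refl\<^sub>2_def[symmetric] quarter_turn_def[symmetric]
      square_mean_refl\<^sub>1 square_mean_refl\<^sub>2 square_mean_quarter_turn)

lemma square_mean_AE_eq:
  assumes "axes_symmetric \<Omega> u" and "quarter_turn_invariant \<Omega> u"
  shows "AE x in lebesgue_on \<Omega>. square_mean u x = u x"
proof -
  note sym = symmetric_AE[OF assms]
  have 1: "AE x in lebesgue_on \<Omega>. sym_mean refl\<^sub>1 u x = u x"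
    by (rule s1.sym_mean_AE_eq[OF sym(1)])
  have 2: "AE x in lebesgue_on \<Omega>. sym_mean refl\<^sub>2 (sym_mean refl\<^sub>1 u) x = u x"
    using s2.sym_mean_AE_cong[OF 1] s2.sym_mean_AE_eq[OF sym(2)] by eventually_elim simp
  show ?thesis
    unfolding square_mean_def
    using sw.sym_mean_AE_cong[OF 2] sw.sym_mean_AE_eq[OF sym(3)] by eventually_elim simp
qed

text \<open>The three averages give a decreasing chain of fidelities. If its ends agree, every link
  is an equality, so each single average already fixes its argument almost everywhere.\<close>

lemma fidelity_square_mean:
  assumes p: "1 \<le> p" and f: "axes_symmetric \<Omega> f" "quarter_turn_invariant \<Omega> f"
    and fm: "f \<in> borel_measurable (lebesgue_on \<Omega>)" and u: "integrable (lebesgue_on \<Omega>) u"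
  shows "fidelity \<Omega> p f (square_mean u) \<le> fidelity \<Omega> p f u"
    and "\<lbrakk>1 < p; fidelity \<Omega> p f u < \<infinity>; fidelity \<Omega> p f (square_mean u) = fidelity \<Omega> p f u\<rbrakk>
      \<Longrightarrow> AE x in lebesgue_on \<Omega>. square_mean u x = u x"
proof -
  define u1 u2 where "u1 = sym_mean refl\<^sub>1 u" and "u2 = sym_mean refl\<^sub>2 u1"
  have m: "square_mean u = sym_mean swap u2"
    by (simp add: square_mean_def u1_def u2_def)
  have u1: "integrable (lebesgue_on \<Omega>) u1" and u2: "integrable (lebesgue_on \<Omega>) u2"
    unfolding u1_def u2_def using u by (auto intro: s1.integrable_sym_mean s2.integrable_sym_mean)
  note sym = symmetric_AE[OF f]
  note F1 = s1.fidelity_sym_mean[OF p sym(1) fm borel_measurable_integrable[OF u], folded u1_def]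
  note F2 = s2.fidelity_sym_mean[OF p sym(2) fm borel_measurable_integrable[OF u1], folded u2_def]
  note F3 = sw.fidelity_sym_mean[OF p sym(3) fm borel_measurable_integrable[OF u2], folded m]
  show "fidelity \<Omega> p f (square_mean u) \<le> fidelity \<Omega> p f u"
    using F1(1) F2(1) F3(1) by simp
  show "AE x in lebesgue_on \<Omega>. square_mean u x = u x"
    if "1 < p" and fin: "fidelity \<Omega> p f u < \<infinity>" and eq: "fidelity \<Omega> p f (square_mean u) = fidelity \<Omega> p f u"
  proof -
    have "fidelity \<Omega> p f u1 = fidelity \<Omega> p f u" "fidelity \<Omega> p f u2 = fidelity \<Omega> p f u"
      using F1(1) F2(1) F3(1) eq by simp_all
    then have "AE x in lebesgue_on \<Omega>. u1 x = u x" "AE x in lebesgue_on \<Omega>. u2 x = u1 x"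
      "AE x in lebesgue_on \<Omega>. square_mean u x = u2 x"
      using F1(2) F2(2) F3(2) \<open>1 < p\<close> fin eq by simp_all
    then show ?thesis
      by eventually_elim simp
  qed
qed

end

theorem theorem7:
  fixes \<Omega> :: "(real^2) set" and f :: "real^2 \<Rightarrow> real" and \<alpha> \<beta> C\<^sub>B\<^sub>D p :: real
  assumes "centred_open_square \<Omega>"
    and "f \<in> BV \<Omega>"
    and "axes_symmetric \<Omega> f"
    and "quarter_turn_invariant \<Omega> f"
    and "sobolev_korn_constant \<Omega> C\<^sub>B\<^sub>D"
    and "\<alpha> > 0" and "\<beta> > 0" and "\<beta> / \<alpha> > C\<^sub>B\<^sub>D"
    and "p \<ge> 1"
  shows "(INF u \<in> BV \<Omega>. TGV_objective \<Omega> p f \<beta> \<alpha> u) = (INF u \<in> BV \<Omega>. TV_objective \<Omega> p f \<alpha> u)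
    \<and> (p > 1 \<longrightarrow> (\<forall>u. TGV_solution \<Omega> p f \<beta> \<alpha> u \<longleftrightarrow> TV_solution \<Omega> p f \<alpha> u))
    \<and> (\<forall>u. TV_solution \<Omega> p f \<alpha> u \<longrightarrow> TGV_solution \<Omega> p f \<beta> \<alpha> u)
    \<and> (\<forall>u. axes_symmetric \<Omega> u \<and> quarter_turn_invariant \<Omega> u \<longrightarrow>
          (TGV_solution \<Omega> p f \<beta> \<alpha> u \<longleftrightarrow> TV_solution \<Omega> p f \<alpha> u))
    \<and> ((\<exists>u. TGV_solution \<Omega> p f \<beta> \<alpha> u) \<longrightarrow>
          (\<exists>u. axes_symmetric \<Omega> u \<and> quarter_turn_invariant \<Omega> u \<and>
             TGV_solution \<Omega> p f \<beta> \<alpha> u \<and> TV_solution \<Omega> p f \<alpha> u))"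
proof -
  interpret symmetric_square \<Omega>
    by (rule symmetric_squareI[OF assms(1,3)])
  let ?G = "TGV_objective \<Omega> p f \<beta> \<alpha>" and ?T = "TV_objective \<Omega> p f \<alpha>"
  have f: "f \<in> borel_measurable (lebesgue_on \<Omega>)"
    using assms(2) by (auto simp: BV_def)
  have int: "integrable (lebesgue_on \<Omega>) u" if "u \<in> BV \<Omega>" for u
    using that by (simp add: BV_def)
  have \<alpha>C: "\<alpha> * C\<^sub>B\<^sub>D \<le> \<beta>"
    using assms(6,8) by (simp add: field_simps)
  have G_le_T: "?G u \<le> ?T u" for u
    unfolding TGV_objective_def TV_objective_def by (intro add_left_mono TGV2_le_TV)
  note TV_le = TV_square_mean_le_TGV2[OF _ assms(5,6) \<alpha>C]
  note fid_le = fidelity_square_mean(1)[OF assms(9,3,4) f int]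
  \<comment> \<open>Together with \<open>G_le_T\<close> this sandwiches \<open>?G u\<close> between
    the TV objective at the mean and at \<open>u\<close>; the minimum and minimiser comparisons rest
    on these two inequalities.\<close>
  have T_le_G: "?T (square_mean u) \<le> ?G u" if "u \<in> BV \<Omega>" for u
    unfolding TGV_objective_def TV_objective_def using that by (intro add_mono TV_le fid_le)
  have T_cong: "?T (square_mean u) = ?T u" if "u \<in> BV \<Omega>" "AE x in lebesgue_on \<Omega>. square_mean u x = u x" for u
    unfolding TV_objective_def using fidelity_AE_cong[OF that(2)] TV_AE_eq[OF square_mean_BV _ that(2)] that(1)
    by simp
  \<comment> \<open>For any competitor \<open>y\<close>:
    \<open>?G u \<le> ?T u \<le> ?T (square_mean y) \<le> ?G y\<close>. The next fact uses
    \<open>?T (square_mean u) \<le> ?G u \<le> ?G y \<le> ?T y\<close>.\<close>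
  have T_imp_G: "TGV_solution \<Omega> p f \<beta> \<alpha> u" if "TV_solution \<Omega> p f \<alpha> u" for u
    using that G_le_T T_le_G square_mean_BV unfolding is_arg_min_linorder by (meson order_trans)
  have G_imp_mean: "TV_solution \<Omega> p f \<alpha> (square_mean u)" if "TGV_solution \<Omega> p f \<beta> \<alpha> u" for u
    using that G_le_T T_le_G square_mean_BV unfolding is_arg_min_linorder by (meson order_trans)
  have G_imp_T: "TV_solution \<Omega> p f \<alpha> u"
    if "TGV_solution \<Omega> p f \<beta> \<alpha> u" "AE x in lebesgue_on \<Omega>. square_mean u x = u x" for u
    using G_imp_mean[OF that(1)] T_cong[OF _ that(2)] that(1) unfolding is_arg_min_linorder by simp
  \<comment> \<open>Averaging cannot lower the fidelity of a minimiser, because the mean has no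
    larger regularisation term. The fidelities therefore agree and the equality case
    applies.\<close>
  have strict: "AE x in lebesgue_on \<Omega>. square_mean u x = u x"
    if "1 < p" and sol: "TGV_solution \<Omega> p f \<beta> \<alpha> u" for u
  proof -
    have u: "u \<in> BV \<Omega>" and min: "\<And>y. y \<in> BV \<Omega> \<Longrightarrow> ?G u \<le> ?G y"
      using sol unfolding is_arg_min_linorder by auto
    \<comment> \<open>The datum \<open>f\<close> is a competitor with zero fidelity and finite total
      variation, so both terms are finite at the minimiser.\<close>
    have "TV \<Omega> f < \<infinity>"
      unfolding TV_def using assms(2) by (intro radon_norm_finite) (simp add: BV_def)
    then have "?T f < \<infinity>"
      by (simp add: TV_objective_def fidelity_same ennreal_mult_less_top)
    then have "?G u < \<infinity>"
      using min[OF assms(2)] G_le_T[of f] by (meson le_less_trans)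
    then have fin: "fidelity \<Omega> p f u < \<infinity>" "TGV2 \<Omega> \<beta> \<alpha> u < \<infinity>"
      by (auto simp: TGV_objective_def)
    have "?G u \<le> ?T (square_mean u)"
      using min[OF square_mean_BV[OF u]] G_le_T by (rule order_trans)
    also have "\<dots> \<le> fidelity \<Omega> p f (square_mean u) + TGV2 \<Omega> \<beta> \<alpha> u"
      unfolding TV_objective_def by (intro add_left_mono TV_le u)
    \<comment> \<open>The common summand \<open>TGV2\<close> is finite and may therefore be
      cancelled in \<open>ennreal\<close>.\<close>
    finally have "fidelity \<Omega> p f u \<le> fidelity \<Omega> p f (square_mean u)"
      using fin by (auto simp: TGV_objective_def ennreal_add_left_cancel_le add.commute[of _ "TGV2 \<Omega> \<beta> \<alpha> u"])
    then have "fidelity \<Omega> p f (square_mean u) = fidelity \<Omega> p f u"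
      using fid_le[OF u] by (rule antisym[rotated])
    then show ?thesis
      by (rule fidelity_square_mean(2)[OF assms(9,3,4) f int[OF u] that(1) fin(1)])
  qed
  have "(INF u \<in> BV \<Omega>. ?G u) = (INF u \<in> BV \<Omega>. ?T u)"
  proof (rule antisym)
    show "(INF u \<in> BV \<Omega>. ?G u) \<le> (INF u \<in> BV \<Omega>. ?T u)"
      using G_le_T by (intro INF_mono) blast
    show "(INF u \<in> BV \<Omega>. ?T u) \<le> (INF u \<in> BV \<Omega>. ?G u)"
      using T_le_G square_mean_BV by (intro INF_mono) blast
  qed
  moreover have "\<forall>u. TGV_solution \<Omega> p f \<beta> \<alpha> u \<longleftrightarrow> TV_solution \<Omega> p f \<alpha> u" if "1 < p"
    using T_imp_G G_imp_T strict[OF that] by blast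
  moreover have "\<forall>u. axes_symmetric \<Omega> u \<and> quarter_turn_invariant \<Omega> u \<longrightarrow>
      (TGV_solution \<Omega> p f \<beta> \<alpha> u \<longleftrightarrow> TV_solution \<Omega> p f \<alpha> u)"
    using T_imp_G G_imp_T square_mean_AE_eq by blast
  moreover have "(\<exists>u. TGV_solution \<Omega> p f \<beta> \<alpha> u) \<longrightarrow>
      (\<exists>u. axes_symmetric \<Omega> u \<and> quarter_turn_invariant \<Omega> u \<and>
         TGV_solution \<Omega> p f \<beta> \<alpha> u \<and> TV_solution \<Omega> p f \<alpha> u)"
    using G_imp_mean T_imp_G square_mean_symmetric by blast
  ultimately show ?thesis
    using T_imp_G by blast
qed

end
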